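(* For every positive integer $n$, the state complex $\mathcal{S}(QR_n)$ of the positive robotic arm $QR_n$ in an $n\times n$ grid is a CAT(0) cubical complex.
   Context: The robotic arm $QR_n$ consists of $n$ unit links attached sequentially, living in the $n\times n$ grid with its base fixed at the lower left corner $(0,0)$; every link faces north (N) or east (E). Thus positions (states) are the lattice paths of length $n$ from $(0,0)$ with steps N or E; a state is labelled by the set $A\subseteq[n]$ of indices of its north links, so there are $2^n$ states. Allowed moves: (corner switch) for $1\le i\le n-1$, if links $i,i+1$ are N,E or E,N, interchange them; this move involves links $\{i,i+1\}$. (End flip) the last link $n$ may be switched between E and N; this move involves link $\{n\}$. The state complex $\mathcal{S}(QR_n)$ is the cubical complex whose vertices are the states, and where for each state $u$ and each set of $k$ moves all applicable at $u$ whose sets of involved links are pairwise disjoint, the $2^k$ states obtained from $u$ by applying the subsets of these moves are the vertices of a $k$-dimensional cube; cubes are glued along common faces. Each cube is given the Euclidean metric of a unit cube, and the distance between two points is the infimum of lengths of piecewise linear paths joining them. A metric space is CAT(0) if any two points are joined by a unique geodesic and every geodesic triangle is thin: for any chord joining two points on the boundary of the triangle, its length is at most the length of the corresponding chord in a Euclidean comparison triangle with the same side lengths. *)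

theory Defs
  imports "HOL-Analysis.Analysis"
begin

section \<open>CAT(0) metric spaces\<close>

definition geodesic :: "'a set \<Rightarrow> ('a \<Rightarrow> 'a \<Rightarrow> real) \<Rightarrow> 'a \<Rightarrow> 'a \<Rightarrow> (real \<Rightarrow> 'a) \<Rightarrow> bool" where
  "geodesic X d p q g \<longleftrightarrow>
     g ` {0..d p q} \<subseteq> X \<and> g 0 = p \<and> g (d p q) = q \<and>
     (\<forall>s\<in>{0..d p q}. \<forall>t\<in>{0..d p q}. d (g s) (g t) = \<bar>s - t\<bar>)"

definition uniquely_geodesic :: "'a set \<Rightarrow> ('a \<Rightarrow> 'a \<Rightarrow> real) \<Rightarrow> bool" where
  "uniquely_geodesic X d \<longleftrightarrow>
     (\<forall>p\<in>X. \<forall>q\<in>X. (\<exists>g. geodesic X d p q g) \<and>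
        (\<forall>g h. geodesic X d p q g \<longrightarrow> geodesic X d p q h \<longrightarrow> (\<forall>t\<in>{0..d p q}. g t = h t)))"

text \<open>
  The vertices and sides of a triangle are indexed by the three-element type \<open>3\<close>, whose
  addition is modulo 3: side \<open>i\<close> runs from vertex \<open>i\<close> to vertex \<open>i + 1\<close>.  The points
  \<open>g i s\<close> and \<open>g j t\<close> are the ends of a chord, and \<open>a\<close>, \<open>b\<close> are their comparison points.
\<close>

definition thin_triangle ::
  "('a \<Rightarrow> 'a \<Rightarrow> real) \<Rightarrow> (3 \<Rightarrow> 'a) \<Rightarrow> (3 \<Rightarrow> real \<Rightarrow> 'a) \<Rightarrow> bool" where
  "thin_triangle d v g \<longleftrightarrow>
     (\<forall>w :: 3 \<Rightarrow> real ^ 2. (\<forall>i. dist (w i) (w (i + 1)) = d (v i) (v (i + 1))) \<longrightarrow>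
        (\<forall>i j. \<forall>s\<in>{0..d (v i) (v (i + 1))}. \<forall>t\<in>{0..d (v j) (v (j + 1))}.
          \<forall>a\<in>closed_segment (w i) (w (i + 1)). \<forall>b\<in>closed_segment (w j) (w (j + 1)).
            dist (w i) a = s \<longrightarrow> dist (w j) b = t \<longrightarrow> d (g i s) (g j t) \<le> dist a b))"

definition CAT0_space :: "'a set \<Rightarrow> ('a \<Rightarrow> 'a \<Rightarrow> real) \<Rightarrow> bool" where
  "CAT0_space X d \<longleftrightarrow>
     Metric_space X d \<and> uniquely_geodesic X d \<and>
     (\<forall>v g. (\<forall>i. v i \<in> X) \<longrightarrow> (\<forall>i. geodesic X d (v i) (v (i + 1)) (g i)) \<longrightarrow> thin_triangle d v g)"

section \<open>Cubical complexes\<close>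

text \<open>
  A combinatorial cube with vertices in \<open>'v\<close> is a pair \<open>(M, c)\<close>: the finite set \<open>M\<close> indexes its
  directions, and \<open>c S\<close> is the vertex reached from the corner \<open>c {}\<close> along the directions
  in \<open>S \<subseteq> M\<close>.  Only the values of \<open>c\<close> on subsets of \<open>M\<close> matter.

  The point of the unit cube with coordinates \<open>x\<close> is recorded by its multilinear weights on the
  vertices.  These weights determine \<open>x\<close>, are supported exactly on the vertices of the smallest
  face containing the point, and restrict to the weights of each face; so, for the set of points
  defined below as the union of the cubes, two cubes are glued precisely along their common faces.
\<close>

type_synonym ('i, 'v) cube = "'i set \<times> ('i set \<Rightarrow> 'v)"

definition cube_point :: "('i, 'v) cube \<Rightarrow> ('i \<Rightarrow> real) \<Rightarrow> 'v \<Rightarrow> real" where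
  "cube_point C x v =
     (\<Sum>S \<in> {S. S \<subseteq> fst C \<and> snd C S = v}. (\<Prod>i\<in>S. x i) * (\<Prod>i\<in>fst C - S. 1 - x i))"

definition unit_coords :: "('i, 'v) cube \<Rightarrow> ('i \<Rightarrow> real) set" where
  "unit_coords C = {x. \<forall>i\<in>fst C. x i \<in> {0..1}}"

definition cube_carrier :: "('i, 'v) cube \<Rightarrow> ('v \<Rightarrow> real) set" where
  "cube_carrier C = cube_point C ` unit_coords C"

definition cube_faces :: "('i, 'v) cube \<Rightarrow> ('v \<Rightarrow> real) set set" where
  "cube_faces C =
     {cube_point C ` {x \<in> unit_coords C. (\<forall>i\<in>Z. x i = 0) \<and> (\<forall>i\<in>U. x i = 1)} | Z U.
        Z \<subseteq> fst C \<and> U \<subseteq> fst C \<and> Z \<inter> U = {}}"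

definition cubical_complex :: "('i, 'v) cube set \<Rightarrow> bool" where
  "cubical_complex K \<longleftrightarrow>
     (\<forall>C\<in>K. finite (fst C) \<and> inj_on (snd C) (Pow (fst C))) \<and>
     (\<forall>C\<in>K. \<forall>F\<in>cube_faces C. \<exists>D\<in>K. cube_carrier D = F) \<and>
     (\<forall>C\<in>K. \<forall>D\<in>K. cube_carrier C \<inter> cube_carrier D \<noteq> {} \<longrightarrow>
        cube_carrier C \<inter> cube_carrier D \<in> cube_faces C \<inter> cube_faces D)"

definition complex_points :: "('i, 'v) cube set \<Rightarrow> ('v \<Rightarrow> real) set" where
  "complex_points K = (\<Union>C\<in>K. cube_carrier C)"

text \<open>
  \<open>pl_path K p l q\<close>: there is a piecewise linear path of length \<open>l\<close> from \<open>p\<close> to \<open>q\<close>, that is, a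
  finite concatenation of straight segments, each contained in one cube and measured by the
  Euclidean metric of that unit cube.
\<close>

inductive pl_path ::
  "('i, 'v) cube set \<Rightarrow> ('v \<Rightarrow> real) \<Rightarrow> real \<Rightarrow> ('v \<Rightarrow> real) \<Rightarrow> bool" for K where
  const: "p \<in> complex_points K \<Longrightarrow> pl_path K p 0 p"
| segment: "\<lbrakk>C \<in> K; x \<in> unit_coords C; y \<in> unit_coords C; pl_path K (cube_point C y) l q\<rbrakk>
    \<Longrightarrow> pl_path K (cube_point C x) (L2_set (\<lambda>i. x i - y i) (fst C) + l) q"

text \<open>
  The value 0 for points not joined by any path is a dummy; with it, \<open>complex_dist K\<close> is not
  a metric on \<open>complex_points K\<close> unless the complex is connected.
\<close>

definition complex_dist :: "('i, 'v) cube set \<Rightarrow> ('v \<Rightarrow> real) \<Rightarrow> ('v \<Rightarrow> real) \<Rightarrow> real" where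
  "complex_dist K p q =
     (if \<exists>l. pl_path K p l q then Inf {l. pl_path K p l q} else 0)"

definition CAT0_cubical_complex :: "('i, 'v) cube set \<Rightarrow> bool" where
  "CAT0_cubical_complex K \<longleftrightarrow>
     cubical_complex K \<and> CAT0_space (complex_points K) (complex_dist K)"

section \<open>The robotic arm\<close>

text \<open>
  A state of the arm is the set \<open>A \<subseteq> {1..n}\<close> of its north-facing links.  Move \<open>i < n\<close> is the
  corner switch of the links \<open>i\<close>, \<open>i + 1\<close>; move \<open>n\<close> is the end flip.
\<close>

definition QR_states :: "nat \<Rightarrow> nat set set" where
  "QR_states n = Pow {1..n}"

definition QR_links :: "nat \<Rightarrow> nat \<Rightarrow> nat set" where
  "QR_links n i = (if i < n then {i, i + 1} else {n})"

definition QR_applicable :: "nat \<Rightarrow> nat set \<Rightarrow> nat \<Rightarrow> bool" where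
  "QR_applicable n A i \<longleftrightarrow> i \<in> {1..n} \<and> (i < n \<longrightarrow> (i \<in> A \<longleftrightarrow> i + 1 \<notin> A))"

text \<open>
  An applicable move turns around exactly the links it involves: interchanging N,E or E,N
  reverses both links.  Hence applying a set of applicable moves with pairwise disjoint links,
  in any order, amounts to the symmetric difference with the union of their links.
\<close>

definition QR_apply :: "nat \<Rightarrow> nat set \<Rightarrow> nat set \<Rightarrow> nat set" where
  "QR_apply n A S = sym_diff A (\<Union>i\<in>S. QR_links n i)"

definition QR_state_complex :: "nat \<Rightarrow> (nat, nat set) cube set" where
  "QR_state_complex n =
     {(M, QR_apply n A) | M A. A \<in> QR_states n \<and> (\<forall>i\<in>M. QR_applicable n A i) \<and>
        disjoint_family_on (QR_links n) M}"

end

theory Submission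
  imports Defs
begin

text \<open>
  Record a position of the arm by the heights of its path after \<open>0, \<dots>, n\<close> links.  A move changes
  one height by one, so the state complex becomes a subcomplex of the standard cubulation of
  \<open>\<real>\<^sup>n\<close>: its points are the height profiles whose consecutive entries run on a staircase.

  The CAT(0) condition is proved in the form of the Bruhat--Tits inequality: any two points have,
  for each ratio \<open>t\<close>, a point \<open>m\<close> between them such that
  \<open>d(p,m)\<^sup>2 \<le> (1 - t) d(p,q)\<^sup>2 + t d(p,r)\<^sup>2 - t (1 - t) d(q,r)\<^sup>2\<close> for all \<open>p\<close>.  This
  property is inherited by gluing along a common part that meets a shortest path between any two
  points on different sides (Reshetnyak), and a box between two integral profiles that is not
  a single Euclidean cube is such a gluing of smaller boxes.
\<close>

section \<open>The Bruhat--Tits inequality and Reshetnyak gluing\<close>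

text \<open>The classical proof of gluing argues with angles and comparison triangles. Here the
  planar comparisons rest on \<open>CN_quadrilateral\<close> and
  \<open>square_add_le_weighted\<close>: the Euclidean figure only supplies the fractions, chosen so
  that the estimates are equalities in the plane. The rational constants below come from there, and
  this is why the final identities close exactly. The pieces are subsets of one ambient metric space
  and keep its distance, so no quotient metric is formed. The obstacle moves elsewhere: paths that
  realise ambient distances must stay in the box and meet the common part of its two pieces.
  Coordinatewise clamping achieves the first: since the corners of the box are integral profiles, it
  maps cubes to cubes, and it lengthens no segment. Boxes with such corners are therefore the class
  on which the induction runs, and a cut by a half-space has to be rewritten as a box with profile
  corners again. The space is not simply convex in Euclidean space because moves \<open>i\<close>
  and \<open>i + 1\<close> share a link: two consecutive heights can never vary in the same
  cube.\<close>

definition CN_point :: "('a \<Rightarrow> 'a \<Rightarrow> real) \<Rightarrow> 'a set \<Rightarrow> 'a \<Rightarrow> 'a \<Rightarrow> real \<Rightarrow> 'a \<Rightarrow> bool" where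
  "CN_point d S q r t m \<longleftrightarrow> m \<in> S \<and>
     (\<forall>p\<in>S. (d p m)\<^sup>2 \<le> (1 - t) * (d p q)\<^sup>2 + t * (d p r)\<^sup>2 - t * (1 - t) * (d q r)\<^sup>2)"

text \<open>All ratios are demanded, not only midpoints, so geodesics arise directly, without
  completeness and a limit over dyadic ratios. The set \<open>S\<close> is kept apart from
  \<open>d\<close> because the pieces of a gluing carry the ambient distance.\<close>

definition CN_space :: "'a set \<Rightarrow> ('a \<Rightarrow> 'a \<Rightarrow> real) \<Rightarrow> bool" where
  "CN_space S d \<longleftrightarrow> (\<forall>q\<in>S. \<forall>r\<in>S. \<forall>t\<in>{0..1}. \<exists>m. CN_point d S q r t m)"

lemma CN_pointD:
  "CN_point d S q r t m \<Longrightarrow> p \<in> S \<Longrightarrow>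
     (d p m)\<^sup>2 \<le> (1 - t) * (d p q)\<^sup>2 + t * (d p r)\<^sup>2 - t * (1 - t) * (d q r)\<^sup>2"
  by (simp add: CN_point_def)

lemma CN_point_mem: "CN_point d S q r t m \<Longrightarrow> m \<in> S"
  by (simp add: CN_point_def)

lemma CN_spaceE:
  assumes "CN_space S d" "q \<in> S" "r \<in> S" "0 \<le> t" "t \<le> 1"
  obtains m where "CN_point d S q r t m"
  using assms unfolding CN_space_def by force

text \<open>Cauchy-Schwarz, multiplied out to avoid division. Equality holds for
  \<open>u : v = s : (1 - s)\<close>, so nothing is lost when a segment is split at its fraction
  \<open>s\<close>.\<close>

lemma square_add_le_weighted:
  fixes u v s :: real
  assumes "0 \<le> s" "s \<le> 1"
  shows "s * (1 - s) * (u + v)\<^sup>2 \<le> (1 - s) * u\<^sup>2 + s * v\<^sup>2"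
proof -
  have "(1 - s) * u\<^sup>2 + s * v\<^sup>2 - s * (1 - s) * (u + v)\<^sup>2 = ((1 - s) * u - s * v)\<^sup>2"
    by (simp add: power2_eq_square algebra_simps)
  then show ?thesis
    using zero_le_power2[of "(1 - s) * u - s * v"] by linarith
qed

context Metric_space
begin

text \<open>Testing the inequality at \<open>p = q\<close> and \<open>p = r\<close> bounds both
  parts from above; the triangle inequality leaves no slack.\<close>

lemma CN_point_dist:
  assumes "S \<subseteq> M" "CN_point d S q r t m" "q \<in> S" "r \<in> S" "0 \<le> t" "t \<le> 1"
  shows "d q m = t * d q r" "d m r = (1 - t) * d q r"
proof -
  have m: "m \<in> S" using assms CN_point_mem by metis
  have "(d q m)\<^sup>2 \<le> t * (d q r)\<^sup>2 - t * (1 - t) * (d q r)\<^sup>2"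
    using CN_pointD[OF assms(2), of q] assms by (auto simp: subset_iff)
  also have "\<dots> = (t * d q r)\<^sup>2"
    by (simp add: power2_eq_square algebra_simps)
  finally have 1: "d q m \<le> t * d q r"
    by (rule power2_le_imp_le) (use assms in simp)
  have "(d m r)\<^sup>2 \<le> (1 - t) * (d q r)\<^sup>2 - t * (1 - t) * (d q r)\<^sup>2"
    using CN_pointD[OF assms(2), of r] assms by (auto simp: subset_iff commute[of m r] commute[of q r])
  also have "\<dots> = ((1 - t) * d q r)\<^sup>2"
    by (simp add: power2_eq_square algebra_simps)
  finally have 2: "d m r \<le> (1 - t) * d q r"
    by (rule power2_le_imp_le) (use assms in simp)
  have "d q r \<le> d q m + d m r"
    using assms m by (intro triangle) auto
  with 1 2 show "d q m = t * d q r" "d m r = (1 - t) * d q r"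
    by (auto simp: algebra_simps)
qed

text \<open>Testing the inequality at \<open>p = h\<close> makes its right-hand side vanish. All
  uniqueness statements below come from this.\<close>

lemma CN_point_eqI:
  assumes "S \<subseteq> M" "CN_point d S q r t m" "q \<in> S" "r \<in> S"
    and "h \<in> S" "d q h = t * d q r" "d h r = (1 - t) * d q r"
  shows "h = m"
proof -
  have "(d h m)\<^sup>2 \<le> (1 - t) * (t * d q r)\<^sup>2 + t * ((1 - t) * d q r)\<^sup>2 - t * (1 - t) * (d q r)\<^sup>2"
    using CN_pointD[OF assms(2,5)] assms(6,7) by (simp add: commute)
  also have "\<dots> = 0"
    by (simp add: power2_eq_square algebra_simps)
  finally show ?thesis
    using assms CN_point_mem[OF assms(2)] by (auto simp: subset_iff)
qed

text \<open>Existence gives some point of this kind, and uniqueness identifies it with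
  \<open>m\<close>. Hence distances to the two ends alone certify the inequality against all of
  \<open>S\<close>.\<close>

lemma CN_point_of_dist:
  assumes "S \<subseteq> M" "CN_space S d" "q \<in> S" "r \<in> S" "0 \<le> t" "t \<le> 1"
    and "m \<in> S" "d q m = t * d q r" "d m r = (1 - t) * d q r"
  shows "CN_point d S q r t m"
  using assms CN_point_eqI CN_spaceE by metis

lemma CN_point_swap:
  assumes "CN_point d S q r t m"
  shows "CN_point d S r q (1 - t) m"
  using assms unfolding CN_point_def by (auto simp: commute[of r q] algebra_simps)

text \<open>Substituting the inequality for \<open>b\<close> into the one for \<open>m\<close> gives
  exactly the inequality for the ratio \<open>u * v\<close>. This produces the remaining points of a
  path once its crossing point is known.\<close>

lemma CN_point_compose:
  assumes "S \<subseteq> M" "q \<in> S" "r \<in> S" "CN_point d S q r u b" "CN_point d S q b v m"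
    and "0 \<le> u" "u \<le> 1" "0 \<le> v" "v \<le> 1"
  shows "CN_point d S q r (u * v) m"
  unfolding CN_point_def
proof (intro conjI ballI)
  show "m \<in> S" using assms CN_point_mem by metis
  fix p assume p: "p \<in> S"
  have qb: "d q b = u * d q r"
    using CN_point_dist assms by metis
  have "(d p m)\<^sup>2 \<le> (1 - v) * (d p q)\<^sup>2 + v * (d p b)\<^sup>2 - v * (1 - v) * (u * d q r)\<^sup>2"
    using CN_pointD[OF assms(5) p] qb by simp
  also have "\<dots> \<le> (1 - v) * (d p q)\<^sup>2 +
      v * ((1 - u) * (d p q)\<^sup>2 + u * (d p r)\<^sup>2 - u * (1 - u) * (d q r)\<^sup>2)
      - v * (1 - v) * (u * d q r)\<^sup>2"
    using CN_pointD[OF assms(4) p] assms by (simp add: mult_left_mono)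
  also have "\<dots> = (1 - u * v) * (d p q)\<^sup>2 + u * v * (d p r)\<^sup>2 - u * v * (1 - u * v) * (d q r)\<^sup>2"
    by (simp add: power2_eq_square algebra_simps)
  finally show "(d p m)\<^sup>2 \<le> \<dots>" .
qed

text \<open>
  In the plane, equality holds for a convex quadrilateral \<open>a\<close>, \<open>b\<close>, \<open>c\<close>, \<open>e\<close> whose diagonals
  cross at the fraction \<open>s\<close> of \<open>ac\<close> and the fraction \<open>t\<close> of \<open>be\<close>.
\<close>

lemma CN_quadrilateral:
  assumes "S \<subseteq> M" "CN_space S d" "a \<in> S" "b \<in> S" "c \<in> S" "e \<in> S"
    and "0 \<le> s" "s \<le> 1" "0 \<le> t" "t \<le> 1"
  shows "s * (1 - s) * (d a c)\<^sup>2 + t * (1 - t) * (d b e)\<^sup>2 \<le>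
    (1 - s) * ((1 - t) * (d a b)\<^sup>2 + t * (d a e)\<^sup>2) + s * ((1 - t) * (d b c)\<^sup>2 + t * (d c e)\<^sup>2)"
proof -
  \<comment> \<open>\<open>w\<close> need not lie on a geodesic from \<open>a\<close> to
    \<open>c\<close>; it only provides a detour, which in the plane would be the crossing point of
    the diagonals.\<close>
  obtain w where w: "CN_point d S b e t w"
    using CN_spaceE assms by metis
  have "w \<in> S" using w CN_point_mem by metis
  then have "d a c \<le> d a w + d w c"
    using assms by (intro triangle) auto
  then have "(d a c)\<^sup>2 \<le> (d a w + d c w)\<^sup>2"
    by (simp add: commute power_mono)
  then have "s * (1 - s) * (d a c)\<^sup>2 \<le> s * (1 - s) * (d a w + d c w)\<^sup>2"
    using assms by (simp add: mult_left_mono)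
  also have "\<dots> \<le> (1 - s) * (d a w)\<^sup>2 + s * (d c w)\<^sup>2"
    using assms square_add_le_weighted by blast
  also have "\<dots> \<le> (1 - s) * ((1 - t) * (d a b)\<^sup>2 + t * (d a e)\<^sup>2 - t * (1 - t) * (d b e)\<^sup>2)
      + s * ((1 - t) * (d c b)\<^sup>2 + t * (d c e)\<^sup>2 - t * (1 - t) * (d b e)\<^sup>2)"
    using assms CN_pointD[OF w] by (intro add_mono mult_left_mono) auto
  finally show ?thesis
    by (simp add: commute[of c b] algebra_simps)
qed

end

text \<open>Reshetnyak gluing inside a given metric: \<open>through\<close> takes the place of the
  quotient metric, and \<open>CN_Int\<close> makes the common part convex in both pieces.\<close>

locale CN_gluing = Metric_space M d for M :: "'a set" and d +
  fixes U W :: "'a set"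
  assumes U_sub: "U \<subseteq> M" and W_sub: "W \<subseteq> M"
    and CN_U: "CN_space U d" and CN_W: "CN_space W d" and CN_Int: "CN_space (U \<inter> W) d"
    and through: "\<And>x z. x \<in> U \<Longrightarrow> z \<in> W \<Longrightarrow> \<exists>c\<in>U \<inter> W. d x z = d x c + d c z"
begin

lemma swapped: "CN_gluing M d W U"
proof (unfold_locales)
  fix x z assume "x \<in> W" "z \<in> U"
  then obtain c where "c \<in> U \<inter> W" "d z x = d z c + d c x"
    using through by blast
  then show "\<exists>c\<in>W \<inter> U. d x z = d x c + d c z"
    by (intro bexI[of _ c]) (auto simp: commute)
qed (use U_sub W_sub CN_U CN_W CN_Int in \<open>auto simp: Int_commute\<close>)

lemma through_fraction:
  assumes "x \<in> U" "z \<in> W"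
  obtains c s where "c \<in> U \<inter> W" "0 \<le> s" "s \<le> 1" "d x c = s * d x z" "d c z = (1 - s) * d x z"
proof -
  obtain c where c: "c \<in> U \<inter> W" "d x z = d x c + d c z"
    using through assms by blast
  show thesis
  proof (cases "d x z = 0")
    case True
    with c have "d x c = 0" "d c z = 0"
      using nonneg[of x c] nonneg[of c z] by linarith+
    then show thesis using True that[of c 0] c by auto
  next
    case False
    then have "d x z > 0" by (simp add: less_le)
    then show thesis
      using c by (intro that[of c "d x c / d x z"]) (auto simp: field_simps)
  qed
qed

text \<open>Convexity of the common part: its geodesics have the right distances in \<open>U\<close>
  and are therefore the geodesics of \<open>U\<close>.\<close>

lemma CN_point_Int_U:
  assumes "q \<in> U \<inter> W" "r \<in> U \<inter> W" "0 \<le> t" "t \<le> 1" "CN_point d (U \<inter> W) q r t m"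
  shows "CN_point d U q r t m"
proof -
  have S: "U \<inter> W \<subseteq> M" using U_sub by blast
  show ?thesis
    using CN_point_of_dist[OF U_sub CN_U] CN_point_dist[OF S assms(5)] assms CN_point_mem[OF assms(5)]
    by auto
qed

text \<open>The planar model is a triangle with apex \<open>p\<close>, sides \<open>D1\<close> to
  \<open>q\<close> and \<open>D2\<close> to \<open>r\<close>, and points \<open>c1\<close>,
  \<open>c2\<close> at the fractions \<open>s1\<close>, \<open>s2\<close> of these sides; there
  equality holds. The apex is absent from the statement because it will lie in \<open>U\<close>,
  while the quadrilateral \<open>c1\<close>, \<open>q\<close>, \<open>r\<close>, \<open>c2\<close>
  lies in \<open>W\<close>.\<close>

lemma comparison_quadrilateral:
  assumes "c1 \<in> W" "q \<in> W" "r \<in> W" "c2 \<in> W"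
    and "0 < s1" "s1 \<le> 1" "0 < s2" "s2 \<le> 1"
    and "d c1 q = (1 - s1) * D1" "d c2 r = (1 - s2) * D2"
  shows "s2 * (d c1 r)\<^sup>2 + s1 * (d c2 q)\<^sup>2 \<le>
    s1 * (1 - s1) * (1 - s2) * D1\<^sup>2 + (d c1 c2)\<^sup>2 + s1 * s2 * (d q r)\<^sup>2 + s2 * (1 - s1) * (1 - s2) * D2\<^sup>2"
proof -
  have WM: "c1 \<in> M" "c2 \<in> M" "q \<in> M" "r \<in> M" using assms W_sub by auto
  \<comment> \<open>The main case divides by a multiple of \<open>(1 - s1) * (1 - s2)\<close>. If a
    factor vanishes, two corners coincide and both sides are equal.\<close>
  consider "s1 = 1" | "s2 = 1" | "s1 < 1" "s2 < 1" using assms by linarith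
  then show ?thesis
  proof cases
    case 1
    then have "c1 = q" using assms WM by simp
    then show ?thesis using 1 by (simp add: commute)
  next
    case 2
    then have "c2 = r" using assms WM by simp
    then show ?thesis using 2 by (simp add: commute)
  next
    case 3
    \<comment> \<open>In the plane with \<open>c1 = s1 q\<close> and \<open>c2 = s2 r\<close>, the diagonals cross at the fractions \<open>s\<close>, \<open>t\<close>.\<close>
    define N where "N = 1 - s1 * s2"
    have "s1 * s2 < 1"
      using 3 assms mult_strict_mono[of s1 1 s2 1] by simp
    then have N: "N > 0" by (simp add: N_def)
    define t where "t = (1 - s1) / N"
    define s where "s = s2 * (1 - s1) / N"
    have t1: "1 - t = s1 * (1 - s2) / N" and s1': "1 - s = (1 - s2) / N"
      using N by (auto simp: t_def s_def field_simps) (auto simp: N_def algebra_simps)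
    have pos: "0 \<le> t" "0 \<le> s" "0 \<le> 1 - t" "0 \<le> 1 - s"
      unfolding t1 s1' using 3 assms N by (auto simp: t_def s_def)
    have "s * (1 - s) * (d c1 r)\<^sup>2 + t * (1 - t) * (d q c2)\<^sup>2 \<le>
      (1 - s) * ((1 - t) * (d c1 q)\<^sup>2 + t * (d c1 c2)\<^sup>2) + s * ((1 - t) * (d q r)\<^sup>2 + t * (d r c2)\<^sup>2)"
      using assms pos by (intro CN_quadrilateral[OF W_sub CN_W]) auto
    then have "0 \<le> (1 - s) * ((1 - t) * ((1 - s1) * D1)\<^sup>2 + t * (d c1 c2)\<^sup>2)
        + s * ((1 - t) * (d q r)\<^sup>2 + t * ((1 - s2) * D2)\<^sup>2)
        - (s * (1 - s) * (d c1 r)\<^sup>2 + t * (1 - t) * (d c2 q)\<^sup>2)"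
      by (simp add: assms commute[of r c2] commute[of q c2])
    also have "\<dots> = (1 - s1) * (1 - s2) / N\<^sup>2 *
       (s1 * (1 - s1) * (1 - s2) * D1\<^sup>2 + (d c1 c2)\<^sup>2 + s1 * s2 * (d q r)\<^sup>2 + s2 * (1 - s1) * (1 - s2) * D2\<^sup>2
        - (s2 * (d c1 r)\<^sup>2 + s1 * (d c2 q)\<^sup>2))"
      unfolding t1 s1' unfolding t_def s_def using N
      by (simp add: field_simps power2_eq_square)
    finally have "0 \<le> (1 - s1) * (1 - s2) / N\<^sup>2 *
       (s1 * (1 - s1) * (1 - s2) * D1\<^sup>2 + (d c1 c2)\<^sup>2 + s1 * s2 * (d q r)\<^sup>2 + s2 * (1 - s1) * (1 - s2) * D2\<^sup>2
        - (s2 * (d c1 r)\<^sup>2 + s1 * (d c2 q)\<^sup>2))" .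
    moreover have "0 < (1 - s1) * (1 - s2) / N\<^sup>2"
      using 3 N by simp
    ultimately show ?thesis
      by (simp only: zero_le_mult_iff) linarith
  qed
qed

text \<open>Core of the gluing: \<open>p\<close> sees \<open>q\<close> and \<open>r\<close> only
  through \<open>c1\<close> and \<open>c2\<close>. The distance to \<open>m\<close> is bounded by a
  detour through a point \<open>c\<close> between \<open>c1\<close> and \<open>c2\<close>: the
  triangle \<open>p\<close>, \<open>c1\<close>, \<open>c2\<close> lies in \<open>U\<close> and
  everything else in \<open>W\<close>. The estimate of \<open>d c m\<close> leaves the unknown
  distances \<open>d c1 r\<close> and \<open>d c2 q\<close> with weights in the ratio
  \<open>s2 : s1\<close>, precisely the combination that \<open>comparison_quadrilateral\<close>
  controls.\<close>

lemma CN_point_W_extends_generic: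
  assumes "p \<in> U" "q \<in> W" "r \<in> W" "0 < t" "t < 1" "CN_point d W q r t m"
    and c1: "c1 \<in> U \<inter> W" "d p c1 = s1 * d p q" "d c1 q = (1 - s1) * d p q"
    and c2: "c2 \<in> U \<inter> W" "d p c2 = s2 * d p r" "d c2 r = (1 - s2) * d p r"
    and s: "0 < s1" "s1 \<le> 1" "0 < s2" "s2 \<le> 1" "s1 < 1 \<or> s2 < 1"
  shows "(d p m)\<^sup>2 \<le> (1 - t) * (d p q)\<^sup>2 + t * (d p r)\<^sup>2 - t * (1 - t) * (d q r)\<^sup>2"
    (is "_ \<le> ?R")
proof -
  \<comment> \<open>In the plane, the segment from \<open>p\<close> to \<open>m\<close> meets the one from \<open>c1\<close> to \<open>c2\<close> at its fraction \<open>s\<close>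
    with \<open>1/s = (1 - t)/s1 + t/s2\<close>, which is the fraction \<open>l\<close> of the latter.\<close>
  define N where "N = (1 - t) * s2 + t * s1"
  have N: "N > 0" unfolding N_def using assms by (intro add_pos_pos mult_pos_pos) auto
  define k where "k = 1 / N"
  have k: "k > 0" "k * N = 1" using N by (auto simp: k_def)
  define l where "l = t * s1 * k"
  define s where "s = s1 * s2 * k"
  have l1: "1 - l = (1 - t) * s2 * k"
    unfolding l_def using k(2) by (simp add: N_def algebra_simps)
  have s_pos: "0 < s" using k assms by (simp add: s_def)
  \<comment> \<open>This yields \<open>s < 1\<close>, so that \<open>s * (1 - s)\<close> can be
    cancelled at the end. Here at least one crossing point must differ from the vertex behind
    it.\<close>
  have "s1 * s2 < N"
  proof -
    have "N - s1 * s2 = (1 - t) * s2 * (1 - s1) + t * s1 * (1 - s2)"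
      by (simp add: N_def algebra_simps)
    also have "\<dots> > 0"
    proof (cases "s1 < 1")
      case True
      then show ?thesis
        using assms by (intro add_pos_nonneg mult_pos_pos mult_nonneg_nonneg) auto
    next
      case False
      then show ?thesis
        using assms by (intro add_nonneg_pos mult_pos_pos mult_nonneg_nonneg) auto
    qed
    finally show ?thesis by simp
  qed
  then have "s1 * s2 * k < N * k" using k by simp
  then have s_lt: "s < 1" using k(2) unfolding s_def by (simp only: mult.commute)
  have "0 \<le> (1 - t) * s2 * k"
    using k assms by (intro mult_nonneg_nonneg) auto
  then have l: "l \<le> 1"
    unfolding l1[symmetric] by simp
  have l0: "0 \<le> l"
    using k assms unfolding l_def by (intro mult_nonneg_nonneg) auto
  have sM: "U \<inter> W \<subseteq> M" using U_sub by auto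
  obtain c where cI: "CN_point d (U \<inter> W) c1 c2 l c"
    using CN_spaceE[OF CN_Int c1(1) c2(1) l0 l] .
  have cU: "CN_point d U c1 c2 l c"
    using CN_point_Int_U cI c1 c2 l l0 by blast
  have cW: "CN_point d W c1 c2 l c"
    using CN_gluing.CN_point_Int_U[OF swapped, of c1 c2 l c] cI c1 c2 l l0 by (simp add: Int_commute)
  have mem: "c \<in> U" "c \<in> W" "m \<in> W"
    using cU cW assms CN_point_mem by metis+
  let ?A = "(d p q)\<^sup>2" and ?B = "(d p r)\<^sup>2" and ?E = "(d c1 c2)\<^sup>2" and ?G = "(d q r)\<^sup>2"
  have i: "(d p c)\<^sup>2 \<le> (1 - l) * (s1\<^sup>2 * ?A) + l * (s2\<^sup>2 * ?B) - l * (1 - l) * ?E"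
    using CN_pointD[OF cU assms(1)] by (simp add: c1 c2 power_mult_distrib)
  have ii: "(d c m)\<^sup>2 \<le> (1 - t) * (d q c)\<^sup>2 + t * (d r c)\<^sup>2 - t * (1 - t) * ?G"
    using CN_pointD[OF assms(6) mem(2)] by (simp add: commute)
  have iii: "(d q c)\<^sup>2 \<le> (1 - l) * ((1 - s1)\<^sup>2 * ?A) + l * (d c2 q)\<^sup>2 - l * (1 - l) * ?E"
    using CN_pointD[OF cW assms(2)]
    by (simp add: c1 c2 commute[of q c1] commute[of q c2] power_mult_distrib)
  have iv: "(d r c)\<^sup>2 \<le> (1 - l) * (d c1 r)\<^sup>2 + l * ((1 - s2)\<^sup>2 * ?B) - l * (1 - l) * ?E"
    using CN_pointD[OF cW assms(3)]
    by (simp add: c1 c2 commute[of r c1] commute[of r c2] power_mult_distrib)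
  have v: "s2 * (d c1 r)\<^sup>2 + s1 * (d c2 q)\<^sup>2 \<le>
    s1 * (1 - s1) * (1 - s2) * ?A + ?E + s1 * s2 * ?G + s2 * (1 - s1) * (1 - s2) * ?B"
    (is "_ \<le> ?V")
    using assms by (intro comparison_quadrilateral) auto
  have cm: "(d c m)\<^sup>2 \<le> (1 - t) * ((1 - l) * ((1 - s1)\<^sup>2 * ?A)) + t * (l * ((1 - s2)\<^sup>2 * ?B))
      - l * (1 - l) * ?E - t * (1 - t) * ?G + t * (1 - t) * k * ?V"
  proof -
    have "(d c m)\<^sup>2 \<le> (1 - t) * ((1 - l) * ((1 - s1)\<^sup>2 * ?A) + l * (d c2 q)\<^sup>2 - l * (1 - l) * ?E)
       + t * ((1 - l) * (d c1 r)\<^sup>2 + l * ((1 - s2)\<^sup>2 * ?B) - l * (1 - l) * ?E) - t * (1 - t) * ?G"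
      using mult_left_mono[OF iii, of "1 - t"] mult_left_mono[OF iv, of t] ii assms(4,5) by linarith
    also have "\<dots> = (1 - t) * ((1 - l) * ((1 - s1)\<^sup>2 * ?A)) + t * (l * ((1 - s2)\<^sup>2 * ?B))
      - l * (1 - l) * ?E - t * (1 - t) * ?G + t * (1 - t) * k * (s2 * (d c1 r)\<^sup>2 + s1 * (d c2 q)\<^sup>2)"
      unfolding l1 unfolding l_def by (simp add: algebra_simps)
    also have "\<dots> \<le> (1 - t) * ((1 - l) * ((1 - s1)\<^sup>2 * ?A)) + t * (l * ((1 - s2)\<^sup>2 * ?B))
      - l * (1 - l) * ?E - t * (1 - t) * ?G + t * (1 - t) * k * ?V"
      using v assms(4,5) k by (intro add_left_mono mult_left_mono) auto
    finally show ?thesis .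
  qed
  have "d p m \<le> d p c + d c m"
    using assms mem U_sub W_sub by (intro triangle) auto
  then have "(d p m)\<^sup>2 \<le> (d p c + d c m)\<^sup>2"
    by (simp add: power_mono)
  then have "s * (1 - s) * (d p m)\<^sup>2 \<le> s * (1 - s) * (d p c + d c m)\<^sup>2"
    using s_pos s_lt by (simp add: mult_left_mono)
  also have "\<dots> \<le> (1 - s) * (d p c)\<^sup>2 + s * (d c m)\<^sup>2"
    using s_pos s_lt by (intro square_add_le_weighted) auto
  also have "\<dots> \<le> (1 - s) * ((1 - l) * (s1\<^sup>2 * ?A) + l * (s2\<^sup>2 * ?B) - l * (1 - l) * ?E)
     + s * ((1 - t) * ((1 - l) * ((1 - s1)\<^sup>2 * ?A)) + t * (l * ((1 - s2)\<^sup>2 * ?B))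
      - l * (1 - l) * ?E - t * (1 - t) * ?G + t * (1 - t) * k * ?V)"
    using i cm s_pos s_lt by (intro add_mono mult_left_mono) auto
  \<comment> \<open>Since the estimates are sharp in the plane, the coefficients of the four squared
    distances must match. They are compared one at a time; the terms in \<open>?E\<close> cancel.
    The fact \<open>sum\<close> says that \<open>s\<close> is the mean of \<open>s1\<close> and
    \<open>s2\<close> with weights \<open>1 - l\<close> and \<open>l\<close>.\<close>
  also have "\<dots> = s * (1 - s) * ?R" (is "?L = _")
  proof -
    have sum: "(1 - l) * (1 - s1) + l * (1 - s2) = 1 - s"
    proof -
      have "(1 - l) * s1 + l * s2 = s"
        unfolding l1 unfolding l_def s_def by (simp add: algebra_simps)
      then show ?thesis by (simp add: algebra_simps)
    qed
    have A: "(1 - s) * ((1 - l) * s1\<^sup>2) + s * ((1 - t) * ((1 - l) * (1 - s1)\<^sup>2)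
        + t * (1 - t) * k * (s1 * (1 - s1) * (1 - s2))) = s * (1 - s) * (1 - t)"
    proof -
      have h1: "(1 - s) * ((1 - l) * s1\<^sup>2) = s * (1 - t) * ((1 - s) * s1)"
        unfolding l1 by (simp add: s_def power2_eq_square)
      have h2: "t * (1 - t) * k * (s1 * (1 - s1) * (1 - s2)) = (1 - t) * (l * (1 - s1) * (1 - s2))"
        by (simp add: l_def)
      have "(1 - s) * ((1 - l) * s1\<^sup>2) + s * ((1 - t) * ((1 - l) * (1 - s1)\<^sup>2)
        + t * (1 - t) * k * (s1 * (1 - s1) * (1 - s2)))
        = s * (1 - t) * ((1 - s) * s1) + s * ((1 - t) * ((1 - l) * (1 - s1)\<^sup>2) + (1 - t) * (l * (1 - s1) * (1 - s2)))"
        by (simp only: h1 h2)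
      also have "\<dots> = s * (1 - t) * ((1 - s) * s1 + ((1 - l) * (1 - s1) + l * (1 - s2)) * (1 - s1))"
        by (simp add: algebra_simps power2_eq_square)
      finally show ?thesis unfolding sum by (simp add: algebra_simps)
    qed
    have B: "(1 - s) * (l * s2\<^sup>2) + s * (t * (l * (1 - s2)\<^sup>2)
        + t * (1 - t) * k * (s2 * (1 - s1) * (1 - s2))) = s * (1 - s) * t"
    proof -
      have h1: "(1 - s) * (l * s2\<^sup>2) = s * t * ((1 - s) * s2)"
        by (simp add: s_def l_def power2_eq_square)
      have h2: "t * (1 - t) * k * (s2 * (1 - s1) * (1 - s2)) = t * ((1 - l) * (1 - s1) * (1 - s2))"
        unfolding l1 by simp
      have "(1 - s) * (l * s2\<^sup>2) + s * (t * (l * (1 - s2)\<^sup>2)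
        + t * (1 - t) * k * (s2 * (1 - s1) * (1 - s2)))
        = s * t * ((1 - s) * s2) + s * (t * (l * (1 - s2)\<^sup>2) + t * ((1 - l) * (1 - s1) * (1 - s2)))"
        by (simp only: h1 h2)
      also have "\<dots> = s * t * ((1 - s) * s2 + ((1 - l) * (1 - s1) + l * (1 - s2)) * (1 - s2))"
        by (simp add: algebra_simps power2_eq_square)
      finally show ?thesis unfolding sum by (simp add: algebra_simps)
    qed
    have E: "l * (1 - l) = s * (t * (1 - t) * k)"
      unfolding l1 unfolding l_def s_def by simp
    have G: "t * (1 - t) * k * (s1 * s2) = t * (1 - t) * s"
      by (simp add: s_def)
    have "?L = ((1 - s) * ((1 - l) * s1\<^sup>2) + s * ((1 - t) * ((1 - l) * (1 - s1)\<^sup>2)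
        + t * (1 - t) * k * (s1 * (1 - s1) * (1 - s2)))) * ?A
      + ((1 - s) * (l * s2\<^sup>2) + s * (t * (l * (1 - s2)\<^sup>2)
        + t * (1 - t) * k * (s2 * (1 - s1) * (1 - s2)))) * ?B
      + (s * (t * (1 - t) * k) - l * (1 - l)) * ?E
      + s * (t * (1 - t) * k * (s1 * s2) - t * (1 - t)) * ?G"
      by (simp add: ring_distribs)
    also have "\<dots> = s * (1 - s) * ?R"
      unfolding A B G unfolding E by (simp add: algebra_simps)
    finally show ?thesis .
  qed
  finally show ?thesis
    using s_pos s_lt by simp
qed

text \<open>For \<open>p\<close> outside \<open>W\<close> both crossing fractions are positive. If
  both equal 1, then \<open>q\<close> and \<open>r\<close> lie in the common part, and uniqueness
  shows that \<open>m\<close> is also the point that serves \<open>U\<close>.\<close>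

lemma CN_point_W_extends:
  assumes "q \<in> W" "r \<in> W" "0 \<le> t" "t \<le> 1" "CN_point d W q r t m"
  shows "CN_point d (U \<union> W) q r t m"
  unfolding CN_point_def
proof (intro conjI ballI)
  have mW: "m \<in> W" using assms CN_point_mem by metis
  then show "m \<in> U \<union> W" by blast
  fix p assume "p \<in> U \<union> W"
  show "(d p m)\<^sup>2 \<le> (1 - t) * (d p q)\<^sup>2 + t * (d p r)\<^sup>2 - t * (1 - t) * (d q r)\<^sup>2"
  proof (cases "p \<in> W")
    case True
    then show ?thesis using CN_pointD[OF assms(5)] by blast
  next
    case False
    with \<open>p \<in> U \<union> W\<close> have p: "p \<in> U" by blast
    obtain c1 s1 where 1: "c1 \<in> U \<inter> W" "0 \<le> s1" "s1 \<le> 1" "d p c1 = s1 * d p q" "d c1 q = (1 - s1) * d p q"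
      using through_fraction[OF p assms(1)] .
    obtain c2 s2 where 2: "c2 \<in> U \<inter> W" "0 \<le> s2" "s2 \<le> 1" "d p c2 = s2 * d p r" "d c2 r = (1 - s2) * d p r"
      using through_fraction[OF p assms(2)] .
    have M: "p \<in> M" "c1 \<in> M" "c2 \<in> M" "q \<in> M" "r \<in> M" "m \<in> M"
      using p 1 2 assms mW U_sub W_sub by auto
    have "s1 \<noteq> 0" using 1 M False zero[of p c1] by auto
    moreover have "s2 \<noteq> 0" using 2 M False zero[of p c2] by auto
    ultimately have pos: "0 < s1" "0 < s2" using 1 2 by auto
    consider "t = 0" | "t = 1" | "0 < t" "t < 1" "s1 < 1 \<or> s2 < 1" | "s1 = 1" "s2 = 1"
      using assms 1 2 by force
    then show ?thesis
    proof cases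
      case 1
      then have "m = q"
        using CN_point_dist(1)[OF W_sub assms(5,1-4)] M by simp
      then show ?thesis using 1 by simp
    next
      case 2
      then have "m = r"
        using CN_point_dist(2)[OF W_sub assms(5,1-4)] M by simp
      then show ?thesis using 2 by simp
    next
      case 3
      show ?thesis
        by (rule CN_point_W_extends_generic[OF p assms(1,2) 3(1,2) assms(5), where ?c1.0=c1 and ?c2.0=c2 and ?s1.0=s1 and ?s2.0=s2])
          (use 1 2 3 pos in auto)
    next
      case 4
      then have "c1 = q" "c2 = r" using 1 2 M by auto
      then have I: "q \<in> U \<inter> W" "r \<in> U \<inter> W" using 1 2 by auto
      obtain m' where m': "CN_point d (U \<inter> W) q r t m'"
        using CN_spaceE[OF CN_Int I assms(3,4)] .
      have "CN_point d W q r t m'"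
        using CN_gluing.CN_point_Int_U[OF swapped, of q r t m'] I assms m' by (simp add: Int_commute)
      then have "m' = m"
        using CN_point_eqI[OF W_sub assms(5,1,2)] CN_point_dist[OF W_sub _ assms(1-4)] CN_point_mem
        by metis
      then show ?thesis
        using CN_point_Int_U[OF I assms(3,4) m'] CN_pointD p by metis
    qed
  qed
qed

text \<open>This is the inequality at \<open>b\<close> tested only against the common part. Move
  \<open>b\<close> towards \<open>c\<close> by a fraction \<open>e\<close>: the broken path through
  the new point \<open>x\<close> is no shorter than \<open>d q r\<close>. Expanding, dividing by
  \<open>e\<close> and letting \<open>e\<close> tend to 0 gives the claim.\<close>

lemma first_variation:
  assumes "q \<in> U" "r \<in> W" "b \<in> U \<inter> W" "c \<in> U \<inter> W" "0 \<le> u" "u \<le> 1"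
    and "d q b = u * d q r" "d b r = (1 - u) * d q r"
  shows "(d b c)\<^sup>2 \<le> (1 - u) * (d q c)\<^sup>2 + u * (d c r)\<^sup>2 - u * (1 - u) * (d q r)\<^sup>2"
proof -
  let ?Q = "(1 - u) * (d q c)\<^sup>2 + u * (d c r)\<^sup>2 - u * (1 - u) * (d q r)\<^sup>2"
  have "(1 - e) * (d b c)\<^sup>2 \<le> ?Q" if e: "0 < e" "e < 1" for e
  proof -
    obtain x where xI: "CN_point d (U \<inter> W) b c e x"
      using CN_spaceE[OF CN_Int assms(3,4), of e] e by (meson less_imp_le)
    have xU: "CN_point d U b c e x"
      by (rule CN_point_Int_U[OF assms(3,4) _ _ xI]) (use e in auto)
    have xW: "CN_point d W b c e x"
      using CN_gluing.CN_point_Int_U[OF swapped, of b c e x] assms(3,4) e xI by (simp add: Int_commute)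
    have x: "x \<in> U" using xU CN_point_mem by metis
    have "d q r \<le> d q x + d r x"
      using triangle[of q x r] assms x U_sub W_sub by (auto simp: commute[of r x])
    then have "(d q r)\<^sup>2 \<le> (d q x + d r x)\<^sup>2" by (simp add: power_mono)
    then have "u * (1 - u) * (d q r)\<^sup>2 \<le> u * (1 - u) * (d q x + d r x)\<^sup>2"
      using assms by (simp add: mult_left_mono)
    also have "\<dots> \<le> (1 - u) * (d q x)\<^sup>2 + u * (d r x)\<^sup>2"
      using assms by (intro square_add_le_weighted) auto
    also have "\<dots> \<le> (1 - u) * ((1 - e) * (u * d q r)\<^sup>2 + e * (d q c)\<^sup>2 - e * (1 - e) * (d b c)\<^sup>2)
        + u * ((1 - e) * ((1 - u) * d q r)\<^sup>2 + e * (d c r)\<^sup>2 - e * (1 - e) * (d b c)\<^sup>2)"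
      using CN_pointD[OF xU assms(1)] CN_pointD[OF xW assms(2)] assms
      by (intro add_mono mult_left_mono) (auto simp: commute[of r b] commute[of r c])
    also have "\<dots> = u * (1 - u) * (d q r)\<^sup>2 + e * (?Q - (1 - e) * (d b c)\<^sup>2)"
      by (simp add: power2_eq_square algebra_simps)
    finally have "0 \<le> e * (?Q - (1 - e) * (d b c)\<^sup>2)"
      by linarith
    then show ?thesis
      using e by (simp only: zero_le_mult_iff) linarith
  qed
  then have ev: "\<forall>\<^sub>F e in at_right 0. (1 - e) * (d b c)\<^sup>2 \<le> ?Q"
    by (intro eventually_at_rightI[of 0 1]) auto
  have "((\<lambda>e. (1 - e) * (d b c)\<^sup>2) \<longlongrightarrow> (1 - 0) * (d b c)\<^sup>2) (at_right 0)"
    by (intro tendsto_intros)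
  from tendsto_upperbound[OF this ev] show ?thesis
    by simp
qed

text \<open>The segments from \<open>q\<close> and from \<open>p\<close> to \<open>r\<close> enter
  the common part at \<open>b\<close> and \<open>c\<close>, so the quadrilateral \<open>p\<close>,
  \<open>q\<close>, \<open>b\<close>, \<open>c\<close> lies in \<open>U\<close>. Its inequality
  involves the unknowns \<open>d q c\<close> and \<open>d b c\<close>;
  \<open>first_variation\<close> eliminates both at once.\<close>

lemma CN_through_U:
  assumes "p \<in> U" "q \<in> U" "r \<in> W" "b \<in> U \<inter> W" "0 \<le> u" "u \<le> 1"
    and b: "d q b = u * d q r" "d b r = (1 - u) * d q r"
  shows "(d p b)\<^sup>2 \<le> (1 - u) * (d p q)\<^sup>2 + u * (d p r)\<^sup>2 - u * (1 - u) * (d q r)\<^sup>2"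
proof (cases "r \<in> U")
  case True
  then have "CN_point d U q r u b"
    using assms by (intro CN_point_of_dist[OF U_sub CN_U]) auto
  then show ?thesis using CN_pointD assms by metis
next
  case False
  obtain c s where c: "c \<in> U \<inter> W" "0 \<le> s" "s \<le> 1" "d p c = s * d p r" "d c r = (1 - s) * d p r"
    using through_fraction[OF assms(1,3)] .
  have M: "p \<in> M" "q \<in> M" "r \<in> M" "b \<in> M" "c \<in> M" using assms c U_sub W_sub by auto
  have fv: "(d b c)\<^sup>2 \<le> (1 - u) * (d q c)\<^sup>2 + u * (d c r)\<^sup>2 - u * (1 - u) * (d q r)\<^sup>2"
    using assms c by (intro first_variation) auto
  have "s \<noteq> 1" using False c M zero[of c r] by auto
  then have s1: "s < 1" using c by simp
  show ?thesis
  proof (cases "u = 0 \<or> s = 0")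
    case True
    then show ?thesis
    proof
      assume "u = 0"
      then show ?thesis using b M by simp
    next
      assume "s = 0"
      then have "c = p" using c M by simp
      then show ?thesis using fv by (simp add: commute)
    qed
  next
    case False
    then have pos: "0 < u" "0 < s" using assms c by auto
    \<comment> \<open>With \<open>r\<close> as origin, \<open>b = (1 - u) q\<close> and
      \<open>c = (1 - s) p\<close> in the plane. The diagonals from \<open>p\<close> to
      \<open>b\<close> and from \<open>q\<close> to \<open>c\<close> then cross at the fractions
      \<open>s'\<close> and \<open>t\<close>, with \<open>N = 1 - (1 - s) * (1 - u)\<close>.\<close>
    define N where "N = s * (1 - u) + u"
    have N: "N > 0" unfolding N_def using pos assms by (intro add_nonneg_pos) auto
    define s' where "s' = s / N"
    define t where "t = u / N"
    have s': "1 - s' = u * (1 - s) / N" and t: "1 - t = s * (1 - u) / N"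
      using N by (auto simp: t_def s'_def field_simps) (auto simp: N_def algebra_simps)
    have "0 \<le> s'" "0 \<le> 1 - s'" "0 \<le> t" "0 \<le> 1 - t"
      unfolding s' t unfolding s'_def t_def using N pos assms c by auto
    then have "s' * (1 - s') * (d p b)\<^sup>2 + t * (1 - t) * (d q c)\<^sup>2 \<le>
      (1 - s') * ((1 - t) * (d p q)\<^sup>2 + t * (d p c)\<^sup>2) + s' * ((1 - t) * (d q b)\<^sup>2 + t * (d b c)\<^sup>2)"
      using assms c by (intro CN_quadrilateral[OF U_sub CN_U]) auto
    then have "0 \<le> (1 - s') * ((1 - t) * (d p q)\<^sup>2 + t * (s * d p r)\<^sup>2)
        + s' * ((1 - t) * (u * d q r)\<^sup>2 + t * (d b c)\<^sup>2)
        - (s' * (1 - s') * (d p b)\<^sup>2 + t * (1 - t) * (d q c)\<^sup>2)"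
      by (simp add: b c)
    also have "\<dots> = s * u / N\<^sup>2 * ((1 - s) * (1 - u) * (d p q)\<^sup>2 + (1 - s) * u * s * (d p r)\<^sup>2
        + s * (1 - u) * u * (d q r)\<^sup>2 + (d b c)\<^sup>2 - (1 - s) * (d p b)\<^sup>2 - (1 - u) * (d q c)\<^sup>2)"
      unfolding s' t unfolding s'_def t_def using N
      by (simp add: field_simps power2_eq_square)
    finally have "0 \<le> s * u / N\<^sup>2 * ((1 - s) * (1 - u) * (d p q)\<^sup>2 + (1 - s) * u * s * (d p r)\<^sup>2
        + s * (1 - u) * u * (d q r)\<^sup>2 + (d b c)\<^sup>2 - (1 - s) * (d p b)\<^sup>2 - (1 - u) * (d q c)\<^sup>2)" .
    moreover have "0 < s * u / N\<^sup>2"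
      using N pos by simp
    ultimately have "(1 - s) * (d p b)\<^sup>2 \<le> (1 - s) * (1 - u) * (d p q)\<^sup>2 + (1 - s) * u * s * (d p r)\<^sup>2
        + s * (1 - u) * u * (d q r)\<^sup>2 + (d b c)\<^sup>2 - (1 - u) * (d q c)\<^sup>2"
      by (simp only: zero_le_mult_iff) linarith
    also have "\<dots> \<le> (1 - s) * (1 - u) * (d p q)\<^sup>2 + (1 - s) * u * s * (d p r)\<^sup>2
        + s * (1 - u) * u * (d q r)\<^sup>2 + u * ((1 - s) * d p r)\<^sup>2 - u * (1 - u) * (d q r)\<^sup>2"
      using fv c by simp
    also have "\<dots> = (1 - s) * ((1 - u) * (d p q)\<^sup>2 + u * (d p r)\<^sup>2 - u * (1 - u) * (d q r)\<^sup>2)"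
      by (simp add: power2_eq_square algebra_simps)
    finally show ?thesis
      using s1 by simp
  qed
qed

lemma CN_point_through:
  assumes "q \<in> U" "r \<in> W" "b \<in> U \<inter> W" "0 \<le> u" "u \<le> 1"
    and b: "d q b = u * d q r" "d b r = (1 - u) * d q r"
  shows "CN_point d (U \<union> W) q r u b"
  unfolding CN_point_def
proof (intro conjI ballI)
  show "b \<in> U \<union> W" using assms by blast
  fix p assume "p \<in> U \<union> W"
  then show "(d p b)\<^sup>2 \<le> (1 - u) * (d p q)\<^sup>2 + u * (d p r)\<^sup>2 - u * (1 - u) * (d q r)\<^sup>2"
  proof
    assume "p \<in> U"
    then show ?thesis using CN_through_U assms by blast
  next
    assume "p \<in> W"
    then have "(d p b)\<^sup>2 \<le> (1 - (1 - u)) * (d p r)\<^sup>2 + (1 - u) * (d p q)\<^sup>2 - (1 - u) * (1 - (1 - u)) * (d r q)\<^sup>2"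
      using assms by (intro CN_gluing.CN_through_U[OF swapped]) (auto simp: commute)
    then show ?thesis by (simp add: algebra_simps commute[of r q])
  qed
qed

text \<open>The crossing point \<open>b\<close> already satisfies the inequality at its own ratio
  \<open>u\<close>. Any other ratio falls on the part before \<open>b\<close>, which lies in
  \<open>U\<close>, or after it, in \<open>W\<close>, and is reached by composition.\<close>

lemma CN_point_exists_UW:
  assumes "q \<in> U" "r \<in> W" "0 \<le> t" "t \<le> 1"
  shows "\<exists>m. CN_point d (U \<union> W) q r t m"
proof -
  obtain b u where b: "b \<in> U \<inter> W" "0 \<le> u" "u \<le> 1" "d q b = u * d q r" "d b r = (1 - u) * d q r"
    using through_fraction[OF assms(1,2)] .
  have bp: "CN_point d (U \<union> W) q r u b"
    using CN_point_through assms b by blast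
  have sub: "U \<union> W \<subseteq> M" using U_sub W_sub by blast
  show ?thesis
  proof (cases "t \<le> u")
    case True
    \<comment> \<open>For \<open>u = 0\<close> the condition on \<open>t\<close> forces
      \<open>t = 0\<close>, so the value 0 is right.\<close>
    define v where "v = (if u = 0 then 0 else t / u)"
    have v: "0 \<le> v" "v \<le> 1" "u * v = t" using True assms by (auto simp: v_def)
    obtain m where "CN_point d U q b v m"
      using CN_spaceE[OF CN_U] assms b v by blast
    then have "CN_point d (U \<union> W) q b v m"
      using CN_gluing.CN_point_W_extends[OF swapped, of q b v m] assms b v by (simp add: Un_commute)
    then show ?thesis
      using CN_point_compose[OF sub _ _ bp] assms b v by blast
  next
    case False
    define v where "v = (1 - t) / (1 - u)"
    have v: "0 \<le> v" "v \<le> 1" "(1 - u) * v = 1 - t" using False assms by (auto simp: v_def)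
    obtain m where "CN_point d W r b v m"
      using CN_spaceE[OF CN_W] assms b v by blast
    then have "CN_point d (U \<union> W) r b v m"
      using CN_point_W_extends assms b v by blast
    then have "CN_point d (U \<union> W) r q (1 - t) m"
      using CN_point_compose[OF sub _ _ CN_point_swap[OF bp], of v m] assms b v by auto
    then show ?thesis
      using CN_point_swap by force
  qed
qed

theorem CN_space_Un: "CN_space (U \<union> W) d"
  unfolding CN_space_def
proof (intro ballI)
  fix q r and t :: real assume *: "q \<in> U \<union> W" "r \<in> U \<union> W" "t \<in> {0..1}"
  then have t: "0 \<le> t" "t \<le> 1" by auto
  consider "q \<in> U" "r \<in> U" | "q \<in> W" "r \<in> W" | "q \<in> U" "r \<in> W" | "q \<in> W" "r \<in> U"
    using * by blast
  then show "\<exists>m. CN_point d (U \<union> W) q r t m"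
  proof cases
    case 1
    then show ?thesis
      using CN_gluing.CN_point_W_extends[OF swapped] t CN_spaceE[OF CN_U]
      by (metis Un_commute)
  next
    case 2
    then show ?thesis
      using CN_point_W_extends t CN_spaceE[OF CN_W] by metis
  next
    case 3
    then show ?thesis using CN_point_exists_UW t by blast
  next
    case 4
    then show ?thesis using CN_gluing.CN_point_exists_UW[OF swapped] t
      by (metis Un_commute)
  qed
qed

end

section \<open>From the Bruhat--Tits inequality to CAT(0)\<close>

lemma dist_convex_combination_squared:
  fixes w w' z :: "'a :: real_inner"
  shows "(dist z ((1 - t) *\<^sub>R w + t *\<^sub>R w'))\<^sup>2
    = (1 - t) * (dist z w)\<^sup>2 + t * (dist z w')\<^sup>2 - t * (1 - t) * (dist w w')\<^sup>2"
  unfolding dist_norm power2_norm_eq_inner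
  by (simp add: inner_diff_left inner_diff_right inner_add_left inner_add_right inner_commute algebra_simps)

lemma three_add: "(i :: 3) + 1 + 1 + 1 = i"
  by simp

text \<open>Two sides of a triangle coincide or are consecutive in one of the two orders, which
  leaves only chords between adjacent sides to be compared.\<close>

lemma three_cases: "(j :: 3) = i \<or> j = i + 1 \<or> i = j + 1"
  using exhaust_3[of i] exhaust_3[of j] by auto

context Metric_space
begin

text \<open>The points \<open>m t\<close> for all ratios form the geodesic: the inequality for
  \<open>m t\<close> tested at \<open>m s\<close> bounds their distance above, and the distances
  from \<open>p\<close> bound it below.\<close>

lemma CN_uniquely_geodesic:
  assumes "CN_space M d"
  shows "uniquely_geodesic M d"
  unfolding uniquely_geodesic_def
proof (intro ballI conjI allI impI)
  fix p q assume p: "p \<in> M" "q \<in> M"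
  let ?D = "d p q"
  have "\<forall>t\<in>{0..1}. \<exists>m. CN_point d M p q t m"
    using assms p unfolding CN_space_def by blast
  then obtain m where m: "\<And>t. t \<in> {0..1} \<Longrightarrow> CN_point d M p q t (m t)"
    by metis
  have mM: "m t \<in> M" if "t \<in> {0..1}" for t
    using m that CN_point_mem by metis
  have pm: "d p (m t) = t * ?D" and mq: "d (m t) q = (1 - t) * ?D" if "t \<in> {0..1}" for t
    using CN_point_dist[OF order_refl m[OF that]] p that by auto
  have mm: "d (m s) (m t) = \<bar>s - t\<bar> * ?D" if st: "s \<in> {0..1}" "t \<in> {0..1}" for s t
  proof (rule antisym)
    have "(d (m s) (m t))\<^sup>2 \<le> (1 - t) * (s * ?D)\<^sup>2 + t * ((1 - s) * ?D)\<^sup>2 - t * (1 - t) * ?D\<^sup>2"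
      using CN_pointD[OF m[OF st(2)] mM[OF st(1)]] pm[OF st(1)] mq[OF st(1)]
      by (simp add: commute[of "m s" p])
    also have "\<dots> = (\<bar>s - t\<bar> * ?D)\<^sup>2"
      by (simp add: power_mult_distrib) (simp add: power2_eq_square algebra_simps)
    finally show "d (m s) (m t) \<le> \<bar>s - t\<bar> * ?D"
      by (rule power2_le_imp_le) simp
    have "s * ?D - t * ?D \<le> d (m s) (m t)" "t * ?D - s * ?D \<le> d (m s) (m t)"
      using triangle[of p "m t" "m s"] triangle[of p "m s" "m t"] p mM st pm
      by (auto simp: commute[of "m t" "m s"])
    then show "\<bar>s - t\<bar> * ?D \<le> d (m s) (m t)"
      by (auto simp: abs_if algebra_simps)
  qed
  \<comment> \<open>This also covers \<open>?D = 0\<close>, where division by zero gives 0 and the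
    geodesic is a single point.\<close>
  have div: "s / ?D \<in> {0..1}" if "s \<in> {0..?D}" for s
    using that by (auto simp: divide_le_eq_1)
  show "\<exists>g. geodesic M d p q g"
  proof
    show "geodesic M d p q (\<lambda>s. m (s / ?D))"
      unfolding geodesic_def
    proof (intro conjI ballI)
      show "(\<lambda>s. m (s / ?D)) ` {0..?D} \<subseteq> M"
        using div mM by blast
      show "m (0 / ?D) = p"
        using pm[of 0] p mM[of 0] by simp
      show "m (?D / ?D) = q"
      proof (cases "?D = 0")
        case True
        then show ?thesis using pm[of 0] p mM[of 0] by simp
      next
        case False
        then show ?thesis using mq[of 1] p mM[of 1] by simp
      qed
      fix s t assume st: "s \<in> {0..?D}" "t \<in> {0..?D}"
      show "d (m (s / ?D)) (m (t / ?D)) = \<bar>s - t\<bar>"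
      proof (cases "?D = 0")
        case True
        then show ?thesis using st mm[of 0 0] by simp
      next
        case False
        then have "?D > 0" by (simp add: less_le)
        then show ?thesis
          using mm[OF div[OF st(1)] div[OF st(2)]]
          by (simp add: diff_divide_distrib[symmetric] abs_divide)
      qed
    qed
  qed
  have unique: "g s = m (s / ?D)" if g: "geodesic M d p q g" and s: "s \<in> {0..?D}" for g s
  proof (rule CN_point_eqI[OF order_refl m[OF div[OF s]] p])
    have D: "s / ?D * ?D = s" using s by auto
    have ends: "0 \<in> {0..?D}" "?D \<in> {0..?D}" by simp_all
    have iso: "d (g s) (g t) = \<bar>s - t\<bar>" if "s \<in> {0..?D}" "t \<in> {0..?D}" for s t
      using g that unfolding geodesic_def by blast
    have g': "g 0 = p" "g ?D = q" "g s \<in> M" "d (g 0) (g s) = \<bar>0 - s\<bar>" "d (g s) (g ?D) = \<bar>s - ?D\<bar>"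
      using g s iso[OF ends(1) s] iso[OF s ends(2)] unfolding geodesic_def by blast+
    then show "g s \<in> M" by blast
    show "d p (g s) = s / ?D * ?D"
      unfolding D using g'(1,4) s by simp
    have "(1 - s / ?D) * ?D = ?D - s"
      unfolding left_diff_distrib D by simp
    then show "d (g s) q = (1 - s / ?D) * ?D"
      using g'(2,5) s by simp
  qed
  fix g h t assume "geodesic M d p q g" "geodesic M d p q h" "t \<in> {0..?D}"
  then show "g t = h t" using unique by metis
qed

lemma geodesic_CN_point:
  assumes "CN_space M d" "p \<in> M" "q \<in> M" "geodesic M d p q g" "0 \<le> t" "t \<le> 1"
  shows "CN_point d M p q t (g (t * d p q))"
proof -
  have s: "t * d p q \<in> {0..d p q}" "0 \<in> {0..d p q}" "d p q \<in> {0..d p q}"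
    using assms by (auto intro: mult_left_le_one_le)
  have *: "d (g s) (g t) = \<bar>s - t\<bar>" if "s \<in> {0..d p q}" "t \<in> {0..d p q}" for s t
    using assms(4) that unfolding geodesic_def by blast
  have "g 0 = p" "g (d p q) = q" using assms(4) unfolding geodesic_def by auto
  then have "d p (g (t * d p q)) = t * d p q" "d (g (t * d p q)) q = (1 - t) * d p q"
    using *[OF s(2,1)] *[OF s(1,3)] s(1) by (auto simp: algebra_simps)
  moreover have "g (t * d p q) \<in> M"
    using assms(4) s(1) unfolding geodesic_def by blast
  ultimately show ?thesis
    using assms by (intro CN_point_of_dist) auto
qed

text \<open>The inequality is used twice: first \<open>x\<close> is compared with the vertices
  \<open>p2\<close> and \<open>p3\<close>, then \<open>y\<close> is compared with \<open>x\<close>.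
  The Euclidean side is the same identity with equality.\<close>

lemma CN_chord:
  fixes a1 :: "'b :: real_inner"
  assumes "CN_space M d" "p1 \<in> M" "p2 \<in> M" "p3 \<in> M"
    and w: "dist a1 a2 = d p1 p2" "dist a2 a3 = d p2 p3" "dist a3 a1 = d p3 p1"
    and s: "0 \<le> s" "s \<le> 1" "CN_point d M p1 p2 s x"
    and t: "0 \<le> t" "t \<le> 1" "CN_point d M p2 p3 t y"
  shows "d x y \<le> dist ((1 - s) *\<^sub>R a1 + s *\<^sub>R a2) ((1 - t) *\<^sub>R a2 + t *\<^sub>R a3)"
    (is "_ \<le> dist ?a ?b")
proof (rule power2_le_imp_le)
  have x: "x \<in> M" using s CN_point_mem by metis
  have 2: "(d x p2)\<^sup>2 \<le> (dist ?a a2)\<^sup>2"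
    using CN_pointD[OF s(3) assms(3)] w dist_convex_combination_squared[of a2 s a1 a2] assms
    by (simp add: commute[of p2 x] commute[of p2 p1] dist_commute)
  have 3: "(d x p3)\<^sup>2 \<le> (dist ?a a3)\<^sup>2"
    using CN_pointD[OF s(3) assms(4)] w dist_convex_combination_squared[of a3 s a1 a2]
    by (simp add: commute[of p3 x] commute[of p3 p2] dist_commute[of a3] dist_commute[of a2 a1])
  have "(d x y)\<^sup>2 \<le> (1 - t) * (d x p2)\<^sup>2 + t * (d x p3)\<^sup>2 - t * (1 - t) * (d p2 p3)\<^sup>2"
    using CN_pointD[OF t(3) x] .
  also have "\<dots> \<le> (1 - t) * (dist ?a a2)\<^sup>2 + t * (dist ?a a3)\<^sup>2 - t * (1 - t) * (dist a2 a3)\<^sup>2"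
    using 2 3 t w by (intro diff_mono add_mono mult_left_mono) auto
  also have "\<dots> = (dist ?a ?b)\<^sup>2"
    by (rule dist_convex_combination_squared[symmetric])
  finally show "(d x y)\<^sup>2 \<le> (dist ?a ?b)\<^sup>2" .
qed simp

lemma CN_thin_triangle:
  assumes CN: "CN_space M d" and v: "\<And>i. v i \<in> M"
    and g: "\<And>i. geodesic M d (v i) (v (i + 1)) (g i)"
  shows "thin_triangle d v g"
  unfolding thin_triangle_def
proof (intro allI impI ballI)
  fix w :: "3 \<Rightarrow> real^2" and i j s t a b
  assume w: "\<forall>i. dist (w i) (w (i + 1)) = d (v i) (v (i + 1))"
    and st: "s \<in> {0..d (v i) (v (i + 1))}" "t \<in> {0..d (v j) (v (j + 1))}"
    and ab: "a \<in> closed_segment (w i) (w (i + 1))" "b \<in> closed_segment (w j) (w (j + 1))"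
      "dist (w i) a = s" "dist (w j) b = t"
  have param: "\<exists>l. 0 \<le> l \<and> l \<le> 1 \<and> a = (1 - l) *\<^sub>R w i + l *\<^sub>R w (i + 1) \<and>
      CN_point d M (v i) (v (i + 1)) l (g i (dist (w i) a))"
    if a: "a \<in> closed_segment (w i) (w (i + 1))" for i a
  proof -
    obtain l where l: "0 \<le> l" "l \<le> 1" "a = (1 - l) *\<^sub>R w i + l *\<^sub>R w (i + 1)"
      using a by (auto simp: in_segment)
    have "w i - a = l *\<^sub>R (w i - w (i + 1))"
      using l(3) by (simp add: algebra_simps)
    then have "dist (w i) a = l * d (v i) (v (i + 1))"
      using l w unfolding dist_norm by simp
    then show ?thesis
      using l geodesic_CN_point[OF CN v v g, of l i] by metis
  qed
  obtain l where l: "0 \<le> l" "l \<le> 1" "a = (1 - l) *\<^sub>R w i + l *\<^sub>R w (i + 1)"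
      "CN_point d M (v i) (v (i + 1)) l (g i s)"
    using param[OF ab(1)] ab(3) by auto
  obtain k where k: "0 \<le> k" "k \<le> 1" "b = (1 - k) *\<^sub>R w j + k *\<^sub>R w (j + 1)"
      "CN_point d M (v j) (v (j + 1)) k (g j t)"
    using param[OF ab(2)] ab(4) by auto
  consider "j = i" | "j = i + 1" | "i = j + 1" using three_cases by blast
  then show "d (g i s) (g j t) \<le> dist a b"
  proof cases
    \<comment> \<open>On a common side the geodesic is isometric, and the comparison chord is at
      least the difference of the distances from \<open>w i\<close>.\<close>
    case 1
    then have "d (g i s) (g j t) = \<bar>s - t\<bar>"
      using g[of i] st unfolding geodesic_def by auto
    also have "\<dots> \<le> dist a b"
      using ab 1 dist_triangle[of "w i" a b] dist_triangle[of "w i" b a] by (auto simp: dist_commute)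
    finally show ?thesis .
  next
    case 2
    have "w (i + 1 + 1 + 1) = w i" "v (i + 1 + 1 + 1) = v i" by (simp_all only: three_add)
    then show ?thesis
      using CN_chord[OF CN v v v, of "w i" "w (i + 1)" i "i + 1" "w (i + 1 + 1)" "i + 1 + 1" l "g i s" k "g j t"]
        w[THEN spec, of i] w[THEN spec, of "i + 1"] w[THEN spec, of "i + 1 + 1"] l k 2
      by simp
  next
    case 3
    have "w (j + 1 + 1 + 1) = w j" "v (j + 1 + 1 + 1) = v j" by (simp_all only: three_add)
    then have "d (g j t) (g i s) \<le> dist b a"
      using CN_chord[OF CN v v v, of "w j" "w (j + 1)" j "j + 1" "w (j + 1 + 1)" "j + 1 + 1" k "g j t" l "g i s"]
        w[THEN spec, of j] w[THEN spec, of "j + 1"] w[THEN spec, of "j + 1 + 1"] l k 3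
      by simp
    then show ?thesis by (simp add: commute dist_commute)
  qed
qed

theorem CN_imp_CAT0: "CN_space M d \<Longrightarrow> CAT0_space M d"
  unfolding CAT0_space_def
  using CN_uniquely_geodesic CN_thin_triangle Metric_space_axioms by blast

end

section \<open>Height profiles and their chain metric\<close>

text \<open>The pairs \<open>(x, y)\<close> form the infinite staircase through
  \<open>(k, k)\<close>, \<open>(k, k + 1)\<close>, \<open>(k + 1, k + 1)\<close> for integers
  \<open>k\<close>. One of two consecutive heights is always integral: moves at neighbouring
  positions share a link and cannot be in progress together.\<close>

definition unit_step :: "real \<Rightarrow> real \<Rightarrow> bool" where
  "unit_step x y \<longleftrightarrow> (y \<in> \<int> \<and> y - 1 \<le> x \<and> x \<le> y) \<or> (x \<in> \<int> \<and> x \<le> y \<and> y \<le> x + 1)"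

definition profiles :: "nat \<Rightarrow> (nat \<Rightarrow> real) set" where
  "profiles n = {H. H 0 = 0 \<and> (\<forall>i<n. unit_step (H i) (H (Suc i))) \<and> (\<forall>i>n. H i = 0)}"

definition integral_profiles :: "nat \<Rightarrow> (nat \<Rightarrow> real) set" where
  "integral_profiles n = {H \<in> profiles n. \<forall>i. H i \<in> \<int>}"

definition box_fun :: "(nat \<Rightarrow> real) \<Rightarrow> (nat \<Rightarrow> real) \<Rightarrow> (nat \<Rightarrow> real) set" where
  "box_fun a b = {H. \<forall>i. a i \<le> H i \<and> H i \<le> b i}"

text \<open>A cube is given by its lowest and highest vertex. The last condition expresses that the
  moves spanning it have disjoint links.\<close>

definition cell :: "nat \<Rightarrow> (nat \<Rightarrow> real) \<Rightarrow> (nat \<Rightarrow> real) \<Rightarrow> bool" where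
  "cell n a b \<longleftrightarrow> a \<in> integral_profiles n \<and> b \<in> integral_profiles n \<and>
     (\<forall>i. a i \<le> b i \<and> b i \<le> a i + 1) \<and> (\<forall>i<n. a i = b i \<or> a (Suc i) = b (Suc i))"

definition cell_adjacent :: "nat \<Rightarrow> (nat \<Rightarrow> real) \<Rightarrow> (nat \<Rightarrow> real) \<Rightarrow> bool" where
  "cell_adjacent n x y \<longleftrightarrow> (\<exists>a b. cell n a b \<and> x \<in> box_fun a b \<and> y \<in> box_fun a b)"

definition l2 :: "nat \<Rightarrow> (nat \<Rightarrow> real) \<Rightarrow> (nat \<Rightarrow> real) \<Rightarrow> real" where
  "l2 n x y = L2_set (\<lambda>i. x i - y i) {..n}"

text \<open>The counterpart of \<open>pl_path\<close> in global height coordinates, which do not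
  change from one cube to the next.\<close>

inductive chain :: "nat \<Rightarrow> (nat \<Rightarrow> real) \<Rightarrow> real \<Rightarrow> (nat \<Rightarrow> real) \<Rightarrow> bool" for n where
  refl: "x \<in> profiles n \<Longrightarrow> chain n x 0 x"
| step: "cell_adjacent n x y \<Longrightarrow> chain n y l z \<Longrightarrow> chain n x (l2 n x y + l) z"

definition chain_dist :: "nat \<Rightarrow> (nat \<Rightarrow> real) \<Rightarrow> (nat \<Rightarrow> real) \<Rightarrow> real" where
  "chain_dist n x y = (if \<exists>l. chain n x l y then Inf {l. chain n x l y} else 0)"

lemma box_funD: "H \<in> box_fun a b \<Longrightarrow> a i \<le> H i \<and> H i \<le> b i"
  by (simp add: box_fun_def)

lemma profiles_zero: "H \<in> profiles n \<Longrightarrow> H 0 = 0" "H \<in> profiles n \<Longrightarrow> i > n \<Longrightarrow> H i = 0"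
  by (auto simp: profiles_def)

lemma profiles_step: "H \<in> profiles n \<Longrightarrow> i < n \<Longrightarrow> unit_step (H i) (H (Suc i))"
  by (auto simp: profiles_def)

lemma integral_profilesD: "h \<in> integral_profiles n \<Longrightarrow> h \<in> profiles n" "h \<in> integral_profiles n \<Longrightarrow> h i \<in> \<int>"
  by (auto simp: integral_profiles_def)

lemma cell_integral: "cell n a b \<Longrightarrow> a \<in> integral_profiles n" "cell n a b \<Longrightarrow> b \<in> integral_profiles n"
  by (auto simp: cell_def)

lemma cellD:
  assumes "cell n a b"
  shows "a i \<le> b i" "b i \<le> a i + 1" "i < n \<Longrightarrow> a i = b i \<or> a (Suc i) = b (Suc i)"
  using assms by (auto simp: cell_def)

lemma Ints_le_cases: "(x::real) \<in> \<int> \<Longrightarrow> y \<in> \<int> \<Longrightarrow> x \<le> y \<Longrightarrow> y \<le> x + 1 \<Longrightarrow> y = x \<or> y = x + 1"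
  by (auto elim!: Ints_cases)

lemma Ints_less_le: "(x::real) \<in> \<int> \<Longrightarrow> y \<in> \<int> \<Longrightarrow> x < y \<Longrightarrow> x + 1 \<le> y"
  by (auto elim!: Ints_cases)

lemma unit_step_slope: "unit_step x y \<Longrightarrow> x \<le> y \<and> y \<le> x + 1"
  by (auto simp: unit_step_def)

lemma unit_step_Ints: "x \<in> \<int> \<Longrightarrow> y \<in> \<int> \<Longrightarrow> unit_step x y \<longleftrightarrow> y = x \<or> y = x + 1"
  using Ints_le_cases[of x y] by (auto simp: unit_step_def)

text \<open>In a unit square the staircase turns one corner, either up the left edge and along the
  top, or along the bottom and up the right edge. These corners are where boxes with two
  neighbouring unit sides will be cut.\<close>

lemma unit_step_corner:
  assumes "\<alpha> \<in> \<int>" "unit_step x y" "\<alpha> \<le> x" "x \<le> \<alpha> + 1"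
  shows "\<alpha> \<le> y \<Longrightarrow> y \<le> \<alpha> + 1 \<Longrightarrow> x \<le> \<alpha> \<or> \<alpha> + 1 \<le> y"
    and "\<alpha> + 1 \<le> y \<Longrightarrow> y \<le> \<alpha> + 2 \<Longrightarrow> y \<le> \<alpha> + 1 \<or> \<alpha> + 1 \<le> x"
proof -
  have \<alpha>1: "\<alpha> + 1 \<in> \<int>" using assms by simp
  show "x \<le> \<alpha> \<or> \<alpha> + 1 \<le> y" if "\<alpha> \<le> y" "y \<le> \<alpha> + 1"
    using assms that Ints_le_cases[of \<alpha> x] Ints_le_cases[of \<alpha> y] unfolding unit_step_def by linarith
  show "y \<le> \<alpha> + 1 \<or> \<alpha> + 1 \<le> x" if "\<alpha> + 1 \<le> y" "y \<le> \<alpha> + 2"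
    using assms that \<alpha>1 Ints_le_cases[of \<alpha> x] Ints_le_cases[of "\<alpha> + 1" y] unfolding unit_step_def by linarith
qed

lemma unit_step_rounding:
  assumes "unit_step x y"
  shows "unit_step (of_int \<lfloor>x\<rfloor>) (of_int \<lfloor>y\<rfloor>)" "unit_step (of_int \<lceil>x\<rceil>) (of_int \<lceil>y\<rceil>)" "x \<in> \<int> \<or> y \<in> \<int>"
proof -
  have le: "x \<le> y" "y \<le> x + 1" using unit_step_slope[OF assms] by auto
  have "\<lfloor>x\<rfloor> \<le> \<lfloor>y\<rfloor>" "\<lfloor>y\<rfloor> \<le> \<lfloor>x\<rfloor> + 1" "\<lceil>x\<rceil> \<le> \<lceil>y\<rceil>" "\<lceil>y\<rceil> \<le> \<lceil>x\<rceil> + 1"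
    using le by linarith+
  then have "real_of_int \<lfloor>x\<rfloor> \<le> of_int \<lfloor>y\<rfloor>" "real_of_int \<lfloor>y\<rfloor> \<le> of_int \<lfloor>x\<rfloor> + 1"
    "real_of_int \<lceil>x\<rceil> \<le> of_int \<lceil>y\<rceil>" "real_of_int \<lceil>y\<rceil> \<le> of_int \<lceil>x\<rceil> + 1"
    by linarith+
  then show "unit_step (of_int \<lfloor>x\<rfloor>) (of_int \<lfloor>y\<rfloor>)" "unit_step (of_int \<lceil>x\<rceil>) (of_int \<lceil>y\<rceil>)"
    by (simp_all add: unit_step_def)
  show "x \<in> \<int> \<or> y \<in> \<int>" using assms by (auto simp: unit_step_def)
qed

lemma integral_profilesI:
  assumes "h 0 = 0" "\<And>i. h i \<in> \<int>" "\<And>i. i < n \<Longrightarrow> h i \<le> h (Suc i) \<and> h (Suc i) \<le> h i + 1" "\<And>i. i > n \<Longrightarrow> h i = 0"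
  shows "h \<in> integral_profiles n"
  using assms by (auto simp: integral_profiles_def profiles_def unit_step_def)

lemma profiles_slope:
  assumes "H \<in> profiles n" "i \<le> j" "j \<le> n"
  shows "H i \<le> H j" "H j \<le> H i + (real j - real i)"
proof -
  have "H i \<le> H j \<and> H j \<le> H i + (real j - real i)"
    using assms(2,3)
  proof (induction j rule: dec_induct)
    case (step m)
    then show ?case using unit_step_slope[OF profiles_step[OF assms(1), of m]] by auto
  qed simp
  then show "H i \<le> H j" "H j \<le> H i + (real j - real i)" by auto
qed

lemma profiles_bounds:
  assumes "H \<in> profiles n"
  shows "0 \<le> H i" "H i \<le> real i"
  using profiles_slope[OF assms, of 0 i] profiles_zero[OF assms] by (cases "i \<le> n"; simp)+

lemma cell_box_profiles:
  assumes c: "cell n a b" and H: "H \<in> box_fun a b"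
  shows "H \<in> profiles n"
  unfolding profiles_def
proof (intro CollectI conjI allI impI)
  have ab: "a \<in> profiles n" "b \<in> profiles n" using c cell_integral integral_profilesD by blast+
  show "H 0 = 0" "i > n \<Longrightarrow> H i = 0" for i
    using ab[THEN profiles_zero(1)] ab[THEN profiles_zero(2)] box_funD[OF H] by (metis order_antisym)+
  fix i assume i: "i < n"
  have Z: "a j \<in> \<int>" "b j \<in> \<int>" for j using c cell_integral integral_profilesD by blast+
  have st: "a i \<le> a (Suc i)" "a (Suc i) \<le> a i + 1" "b i \<le> b (Suc i)" "b (Suc i) \<le> b i + 1"
    using unit_step_slope profiles_step ab i by blast+
  show "unit_step (H i) (H (Suc i))"
    using cellD(3)[OF c i] box_funD[OF H, of i] box_funD[OF H, of "Suc i"] st Z[of i] Z[of "Suc i"]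
    unfolding unit_step_def by fastforce
qed

text \<open>Rounding every coordinate down and up gives the smallest cube containing the
  point.\<close>

lemma rounding_cell:
  assumes "H \<in> profiles n"
  shows "cell n (\<lambda>i. of_int \<lfloor>H i\<rfloor>) (\<lambda>i. of_int \<lceil>H i\<rceil>)"
    and "H \<in> box_fun (\<lambda>i. of_int \<lfloor>H i\<rfloor>) (\<lambda>i. of_int \<lceil>H i\<rceil>)"
proof -
  have "(\<lambda>i. of_int \<lfloor>H i\<rfloor>) \<in> integral_profiles n" "(\<lambda>i. of_int \<lceil>H i\<rceil>) \<in> integral_profiles n"
    using assms unit_step_rounding by (auto simp: integral_profiles_def profiles_def)
  moreover have "real_of_int \<lfloor>H i\<rfloor> = of_int \<lceil>H i\<rceil> \<or> real_of_int \<lfloor>H (Suc i)\<rfloor> = of_int \<lceil>H (Suc i)\<rceil>" if "i < n" for i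
    using unit_step_rounding(3)[OF profiles_step[OF assms that]] by (auto elim!: Ints_cases)
  ultimately show "cell n (\<lambda>i. of_int \<lfloor>H i\<rfloor>) (\<lambda>i. of_int \<lceil>H i\<rceil>)"
    unfolding cell_def by (auto simp: ceiling_altdef)
qed (auto simp: box_fun_def)

lemma cell_adjacent_profiles: "cell_adjacent n x y \<Longrightarrow> x \<in> profiles n \<and> y \<in> profiles n"
  unfolding cell_adjacent_def using cell_box_profiles by blast

lemma cell_adjacent_sym: "cell_adjacent n x y \<Longrightarrow> cell_adjacent n y x"
  unfolding cell_adjacent_def by blast

lemma cell_adjacent_refl: "x \<in> profiles n \<Longrightarrow> cell_adjacent n x x"
  unfolding cell_adjacent_def using rounding_cell by blast

lemma min_integral_profiles:
  assumes "a \<in> integral_profiles n" "b \<in> integral_profiles n"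
  shows "(\<lambda>i. min (a i) (b i)) \<in> integral_profiles n"
proof (rule integral_profilesI)
  fix i assume "i < n"
  then show "min (a i) (b i) \<le> min (a (Suc i)) (b (Suc i)) \<and> min (a (Suc i)) (b (Suc i)) \<le> min (a i) (b i) + 1"
    using assms[THEN integral_profilesD(1), THEN profiles_step, THEN unit_step_slope] by fastforce
qed (use assms in \<open>auto simp: integral_profiles_def profiles_def min_def\<close>)

lemma max_integral_profiles:
  assumes "a \<in> integral_profiles n" "b \<in> integral_profiles n"
  shows "(\<lambda>i. max (a i) (b i)) \<in> integral_profiles n"
proof (rule integral_profilesI)
  fix i assume "i < n"
  then show "max (a i) (b i) \<le> max (a (Suc i)) (b (Suc i)) \<and> max (a (Suc i)) (b (Suc i)) \<le> max (a i) (b i) + 1"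
    using assms[THEN integral_profilesD(1), THEN profiles_step, THEN unit_step_slope] by fastforce
qed (use assms in \<open>auto simp: integral_profiles_def profiles_def max_def\<close>)

section \<open>Lengths of chains, connectedness and the chain metric\<close>

lemma l2_nonneg [simp]: "0 \<le> l2 n x y"
  by (simp add: l2_def)

lemma l2_refl [simp]: "l2 n x x = 0"
  by (simp add: l2_def L2_set_0')

lemma l2_commute: "l2 n x y = l2 n y x"
  unfolding l2_def L2_set_def by (simp add: power2_commute)

lemma l2_triangle: "l2 n x z \<le> l2 n x y + l2 n y z"
  unfolding l2_def using L2_set_triangle_ineq[of "\<lambda>i. x i - y i" "\<lambda>i. y i - z i" "{..n}"] by simp

lemma l2_mono:
  assumes "\<And>i. \<bar>x i - y i\<bar> \<le> \<bar>x' i - y' i\<bar>"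
  shows "l2 n x y \<le> l2 n x' y'"
  unfolding l2_def L2_set_def
  by (intro real_sqrt_le_mono sum_mono) (use assms in \<open>simp add: abs_le_square_iff\<close>)

lemma l2_squared: "(l2 n x y)\<^sup>2 = (\<Sum>i\<le>n. (x i - y i)\<^sup>2)"
  unfolding l2_def L2_set_def by (simp add: sum_nonneg)

lemma chain_profiles: "chain n x l y \<Longrightarrow> x \<in> profiles n \<and> y \<in> profiles n"
  by (induction rule: chain.induct) (use cell_adjacent_profiles in auto)

lemma l2_le_chain: "chain n x l y \<Longrightarrow> l2 n x y \<le> l"
proof (induction rule: chain.induct)
  case (step x y l z)
  then show ?case using l2_triangle[of n x z y] by simp
qed simp

lemma chain_nonneg: "chain n x l y \<Longrightarrow> 0 \<le> l"
  using l2_le_chain l2_nonneg order_trans by blast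

lemma chain_trans: "chain n x l y \<Longrightarrow> chain n y k z \<Longrightarrow> chain n x (l + k) z"
proof (induction rule: chain.induct)
  case (step x y l z)
  then show ?case by (auto simp: add.assoc intro: chain.step)
qed simp

lemma chain_adjacent: "cell_adjacent n x y \<Longrightarrow> chain n x (l2 n x y) y"
  using chain.step[OF _ chain.refl] cell_adjacent_profiles by fastforce

lemma chain_sym: "chain n x l y \<Longrightarrow> chain n y l x"
proof (induction rule: chain.induct)
  case (refl x)
  then show ?case by (rule chain.refl)
next
  case (step x y l z)
  then show ?case
    using chain_trans chain_adjacent[OF cell_adjacent_sym, of n x y]
    by (metis add.commute l2_commute)
qed

text \<open>Descent to the horizontal arm by lowering one height at a time; the sum of the heights
  drops by one, whence the bound \<open>N\<close> for the induction.\<close>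

lemma chain_zero_integral:
  assumes "h \<in> integral_profiles n" "(\<Sum>i\<le>n. h i) \<le> real N"
  shows "\<exists>l. chain n h l (\<lambda>_. 0)"
  using assms
proof (induction N arbitrary: h)
  case 0
  note hp = integral_profilesD(1)[OF 0(1)]
  have "\<forall>i\<le>n. h i = 0"
    using 0(2) profiles_bounds[OF hp] sum_nonneg_eq_0_iff[of "{..n}" h] sum_nonneg[of "{..n}" h] by fastforce
  then have "h = (\<lambda>_. 0)"
    using profiles_zero[OF hp] by (metis linorder_not_le ext)
  then show ?case using chain.refl hp by blast
next
  case (Suc N)
  note hp = integral_profilesD(1)[OF Suc.prems(1)] and hZ = integral_profilesD(2)[OF Suc.prems(1)]
  show ?case
  proof (cases "h n = 0")
    case True
    have "h i = 0" for i
      using profiles_slope(1)[OF hp, of i n] profiles_bounds[OF hp, of i] profiles_zero[OF hp] True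
      by (metis linorder_not_le order_antisym order_refl)
    then have "h = (\<lambda>_. 0)" by auto
    then show ?thesis using chain.refl hp by blast
  next
    case False
    \<comment> \<open>At the first place where the final height is reached, the profile has just
      risen by one and is flat afterwards. Lowering it there keeps all slopes in range.\<close>
    define i where "i = (LEAST i. h i = h n)"
    have hi: "h i = h n" unfolding i_def by (rule LeastI[of _ n]) simp
    have "i \<le> n" unfolding i_def by (rule Least_le) simp
    have "i \<noteq> 0" using hi False profiles_zero(1)[OF hp] by metis
    then obtain k where k: "i = Suc k" by (cases i) auto
    have "h k \<noteq> h n" using not_less_Least[of k "\<lambda>i. h i = h n"] k i_def by simp
    then have "h i = h k + 1"
      using unit_step_Ints[OF hZ hZ] profiles_step[OF hp, of k] k \<open>i \<le> n\<close> hi by force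
    define g where "g = h(i := h i - 1)"
    have flat: "h j = h n" if "i \<le> j" "j \<le> n" for j
      using profiles_slope(1)[OF hp, of i j] profiles_slope(1)[OF hp, of j n] hi that by linarith
    have g: "g \<in> integral_profiles n"
    proof (rule integral_profilesI)
      show "g 0 = 0" "j > n \<Longrightarrow> g j = 0" for j
        using \<open>i \<noteq> 0\<close> \<open>i \<le> n\<close> profiles_zero[OF hp] by (auto simp: g_def)
      show "g j \<in> \<int>" for j using hZ by (auto simp: g_def)
      fix j assume j: "j < n"
      then have hj: "h j \<le> h (Suc j) \<and> h (Suc j) \<le> h j + 1"
        using unit_step_slope profiles_step[OF hp] by blast
      show "g j \<le> g (Suc j) \<and> g (Suc j) \<le> g j + 1"
        using hj \<open>h i = h k + 1\<close> k hi flat[of "Suc i"] j by (auto simp: g_def)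
    qed
    have "cell n g h"
      unfolding cell_def using g Suc.prems(1) by (auto simp: g_def)
    then have "cell_adjacent n h g"
      unfolding cell_adjacent_def by (intro exI[of _ g] exI[of _ h]) (auto simp: box_fun_def g_def)
    have "(\<Sum>i\<le>n. g i) = (\<Sum>i\<le>n. h i) - 1"
    proof -
      have "(\<Sum>j\<le>n. g j) = (\<Sum>j\<le>n. h j - (if j = i then 1 else 0))"
        by (rule sum.cong) (auto simp: g_def)
      also have "\<dots> = (\<Sum>j\<le>n. h j) - 1"
        using \<open>i \<le> n\<close> by (simp add: sum_subtractf)
      finally show ?thesis .
    qed
    then have "(\<Sum>i\<le>n. g i) \<le> real N" using Suc.prems by simp
    then obtain l where "chain n g l (\<lambda>_. 0)" using Suc.IH g by blast
    then show ?thesis using chain.step \<open>cell_adjacent n h g\<close> by blast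
  qed
qed

lemma chain_connected:
  assumes "x \<in> profiles n" "y \<in> profiles n"
  shows "\<exists>l. chain n x l y"
proof -
  have *: "\<exists>l. chain n x l (\<lambda>_. 0)" if x: "x \<in> profiles n" for x
  proof -
    let ?h = "\<lambda>i. real_of_int \<lfloor>x i\<rfloor>"
    have c: "cell n ?h (\<lambda>i. of_int \<lceil>x i\<rceil>)" and xb: "x \<in> box_fun ?h (\<lambda>i. of_int \<lceil>x i\<rceil>)"
      using rounding_cell[OF x] by auto
    have hb: "?h \<in> box_fun ?h (\<lambda>i. of_int \<lceil>x i\<rceil>)"
      unfolding box_fun_def using cellD(1)[OF c] by simp
    have "cell_adjacent n x ?h"
      unfolding cell_adjacent_def using c xb hb by blast
    moreover obtain l where "chain n ?h l (\<lambda>_. 0)"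
      using chain_zero_integral[OF cell_integral(1)[OF c]] real_arch_simple by metis
    ultimately show ?thesis using chain.step by blast
  qed
  from *[OF assms(1)] *[OF assms(2)] show ?thesis
    using chain_sym chain_trans by blast
qed

lemma chain_dist_le: "chain n x l y \<Longrightarrow> chain_dist n x y \<le> l"
  unfolding chain_dist_def using chain_nonneg
  by (auto intro!: cInf_lower bdd_belowI)

lemma chain_dist_approx:
  assumes "x \<in> profiles n" "y \<in> profiles n" "e > 0"
  obtains l where "chain n x l y" "l < chain_dist n x y + e"
proof -
  have "Inf {l. chain n x l y} < chain_dist n x y + e"
    using chain_connected[OF assms(1,2)] assms(3) by (auto simp: chain_dist_def)
  moreover have "{l. chain n x l y} \<noteq> {}"
    using chain_connected[OF assms(1,2)] by blast
  ultimately show thesis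
    using that cInf_lessD[of "{l. chain n x l y}"] by blast
qed

lemma chain_dist_greatest:
  assumes "x \<in> profiles n" "y \<in> profiles n" "\<And>l. chain n x l y \<Longrightarrow> c \<le> l"
  shows "c \<le> chain_dist n x y"
  using chain_connected[OF assms(1,2)] assms(3)
  by (auto simp: chain_dist_def intro!: cInf_greatest)

lemma l2_le_chain_dist:
  "x \<in> profiles n \<Longrightarrow> y \<in> profiles n \<Longrightarrow> l2 n x y \<le> chain_dist n x y"
  by (rule chain_dist_greatest) (use l2_le_chain in auto)

text \<open>The Euclidean distance of the heights bounds every chain from below, so a straight
  segment inside a cube is shortest.\<close>

lemma chain_dist_adjacent: "cell_adjacent n x y \<Longrightarrow> chain_dist n x y = l2 n x y"
  using chain_dist_le[OF chain_adjacent] l2_le_chain_dist cell_adjacent_profiles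
  by (meson order_antisym)

lemma l2_eq_0:
  assumes "x \<in> profiles n" "y \<in> profiles n" "l2 n x y = 0"
  shows "x = y"
proof
  fix i
  have "\<forall>i\<in>{..n}. x i - y i = 0"
    using assms(3) unfolding l2_def by (subst (asm) L2_set_eq_0_iff) auto
  then show "x i = y i"
    using profiles_zero(2)[OF assms(1)] profiles_zero(2)[OF assms(2)] by (cases "i \<le> n") auto
qed

lemma chain_dist_nonneg: "0 \<le> chain_dist n x y"
  unfolding chain_dist_def using chain_nonneg by (auto intro!: cInf_greatest)

lemma chain_dist_metric: "Metric_space (profiles n) (chain_dist n)"
proof
  fix x y
  show "0 \<le> chain_dist n x y"
    by (rule chain_dist_nonneg)
  have "chain n x l y \<longleftrightarrow> chain n y l x" for l using chain_sym by blast
  then show "chain_dist n x y = chain_dist n y x"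
    by (simp add: chain_dist_def)
next
  fix x y assume "x \<in> profiles n" "y \<in> profiles n"
  then show "chain_dist n x y = 0 \<longleftrightarrow> x = y"
    using l2_le_chain_dist[of x n y] l2_eq_0[of x n y] l2_nonneg[of n x y]
      chain_dist_adjacent[OF cell_adjacent_refl, of x n] l2_refl[of n x]
    by (metis order_antisym)
next
  fix x y z assume xyz: "x \<in> profiles n" "y \<in> profiles n" "z \<in> profiles n"
  show "chain_dist n x z \<le> chain_dist n x y + chain_dist n y z"
  proof (rule field_le_epsilon)
    fix e :: real assume "e > 0"
    then obtain l k where "chain n x l y" "l < chain_dist n x y + e / 2"
        "chain n y k z" "k < chain_dist n y z + e / 2"
      using chain_dist_approx xyz half_gt_zero by metis
    then show "chain_dist n x z \<le> chain_dist n x y + chain_dist n y z + e"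
      using chain_dist_le[OF chain_trans[of n x l y k z]] by linarith
  qed
qed

section \<open>Retraction onto boxes that increases no distance, and compactness of boxes\<close>

definition clamp_fun :: "(nat \<Rightarrow> real) \<Rightarrow> (nat \<Rightarrow> real) \<Rightarrow> (nat \<Rightarrow> real) \<Rightarrow> nat \<Rightarrow> real" where
  "clamp_fun a b H = (\<lambda>i. max (a i) (min (b i) (H i)))"

definition profile_box :: "nat \<Rightarrow> (nat \<Rightarrow> real) \<Rightarrow> (nat \<Rightarrow> real) \<Rightarrow> (nat \<Rightarrow> real) set" where
  "profile_box n a b = profiles n \<inter> box_fun a b"

lemma clamp_fun_box: "H \<in> box_fun a b \<Longrightarrow> clamp_fun a b H = H"
  by (auto simp: clamp_fun_def box_fun_def fun_eq_iff)

lemma clamp_fun_in_box: "(\<And>i. a i \<le> b i) \<Longrightarrow> clamp_fun a b H \<in> box_fun a b"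
  by (auto simp: clamp_fun_def box_fun_def)

text \<open>Clamping consists of a minimum and a maximum with integral profiles, and integral
  profiles form a lattice under these operations. So a chain, clamped vertex by vertex, stays a
  chain.\<close>

lemma clamp_fun_cell:
  assumes "a \<in> integral_profiles n" "b \<in> integral_profiles n" "cell n lo hi"
  shows "cell n (clamp_fun a b lo) (clamp_fun a b hi)"
proof -
  have "clamp_fun a b lo \<in> integral_profiles n" "clamp_fun a b hi \<in> integral_profiles n"
    unfolding clamp_fun_def using assms cell_integral
    by (auto intro!: max_integral_profiles min_integral_profiles)
  moreover have "clamp_fun a b lo i \<le> clamp_fun a b hi i \<and> clamp_fun a b hi i \<le> clamp_fun a b lo i + 1" for i
    using cellD(1,2)[OF assms(3), of i] unfolding clamp_fun_def by linarith
  moreover have "clamp_fun a b lo i = clamp_fun a b hi i \<or> clamp_fun a b lo (Suc i) = clamp_fun a b hi (Suc i)"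
    if "i < n" for i
    using cellD(3)[OF assms(3) that] unfolding clamp_fun_def by auto
  ultimately show ?thesis unfolding cell_def by blast
qed

lemma clamp_fun_adjacent:
  assumes "a \<in> integral_profiles n" "b \<in> integral_profiles n" "cell_adjacent n x y"
  shows "cell_adjacent n (clamp_fun a b x) (clamp_fun a b y)"
proof -
  obtain lo hi where c: "cell n lo hi" "x \<in> box_fun lo hi" "y \<in> box_fun lo hi"
    using assms(3) unfolding cell_adjacent_def by blast
  have "clamp_fun a b z \<in> box_fun (clamp_fun a b lo) (clamp_fun a b hi)" if "z \<in> box_fun lo hi" for z
    unfolding box_fun_def clamp_fun_def
    by (intro CollectI allI conjI max.mono min.mono order_refl) (use box_funD[OF that] in auto)
  then show ?thesis
    using clamp_fun_cell[OF assms(1,2) c(1)] c unfolding cell_adjacent_def by blast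
qed

lemma clamp_fun_profile_box:
  assumes "a \<in> integral_profiles n" "b \<in> integral_profiles n" "\<And>i. a i \<le> b i" "x \<in> profiles n"
  shows "clamp_fun a b x \<in> profile_box n a b"
  unfolding profile_box_def
  using clamp_fun_in_box assms(3) clamp_fun_adjacent[OF assms(1,2) cell_adjacent_refl[OF assms(4)]]
    cell_adjacent_profiles by blast

lemma l2_clamp_fun: "l2 n (clamp_fun a b x) (clamp_fun a b y) \<le> l2 n x y"
  by (rule l2_mono) (auto simp: clamp_fun_def max_def min_def)

lemma chain_dist_clamp_fun:
  assumes "a \<in> integral_profiles n" "b \<in> integral_profiles n" "chain n x l y"
  shows "chain_dist n (clamp_fun a b x) (clamp_fun a b y) \<le> l"
proof -
  interpret Metric_space "profiles n" "chain_dist n" by (rule chain_dist_metric)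
  have prof: "clamp_fun a b x \<in> profiles n" if "x \<in> profiles n" for x
    using clamp_fun_adjacent[OF assms(1,2) cell_adjacent_refl[OF that]] cell_adjacent_profiles by blast
  show ?thesis
    using assms(3)
  proof (induction rule: chain.induct)
    case (refl x)
    then show ?case using prof by simp
  next
    case (step x y l z)
    have "chain_dist n (clamp_fun a b x) (clamp_fun a b z)
        \<le> chain_dist n (clamp_fun a b x) (clamp_fun a b y) + chain_dist n (clamp_fun a b y) (clamp_fun a b z)"
      using prof step chain_profiles cell_adjacent_profiles by (intro triangle) blast+
    moreover have "chain_dist n (clamp_fun a b x) (clamp_fun a b y) \<le> l2 n x y"
      using chain_dist_adjacent[OF clamp_fun_adjacent[OF assms(1,2) step(1)]] l2_clamp_fun by metis
    ultimately show ?case using step by linarith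
  qed
qed

lemma closed_profile_box: "closed (profile_box n a b)"
proof -
  have cont: "continuous_on UNIV (\<lambda>H :: nat \<Rightarrow> real. H i)" for i
    by simp
  have Z: "closed {H :: nat \<Rightarrow> real. H i \<in> \<int>}" for i
    using closed_vimage[OF closed_Ints, of "\<lambda>H :: nat \<Rightarrow> real. H i"] cont by (simp add: vimage_def)
  have "profile_box n a b = {H. H 0 = 0} \<inter> (\<Inter>i\<in>{..<n}.
      ({H. H (Suc i) \<in> \<int>} \<inter> {H. H (Suc i) - 1 \<le> H i} \<inter> {H. H i \<le> H (Suc i)}) \<union>
      ({H. H i \<in> \<int>} \<inter> {H. H i \<le> H (Suc i)} \<inter> {H. H (Suc i) \<le> H i + 1}))
      \<inter> (\<Inter>i\<in>{n<..}. {H. H i = 0}) \<inter> (\<Inter>i. {H. a i \<le> H i} \<inter> {H. H i \<le> b i})"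
    unfolding profile_box_def profiles_def box_fun_def unit_step_def by auto
  also have "closed \<dots>"
    by (intro closed_Int closed_INT ballI closed_Un Z closed_Collect_le closed_Collect_eq
        continuous_intros cont)
  finally show ?thesis .
qed

text \<open>Compactness comes from the product topology, in which boxes are closed and bounded. To
  pass to \<open>chain_dist\<close>, late members of the sequence are shown to share a cube with the
  limit, where the distance is Euclidean.\<close>

lemma profile_box_subseq:
  assumes "\<And>k. f k \<in> profile_box n a b"
  obtains r c where "strict_mono (r :: nat \<Rightarrow> nat)" "c \<in> profile_box n a b"
    "(\<lambda>k. chain_dist n (f (r k)) c) \<longlonglongrightarrow> 0"
proof -
  have "compactin (product_topology (\<lambda>i. euclidean) UNIV) (PiE UNIV (\<lambda>i. {0..real i}))"
    by (subst compactin_PiE) auto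
  then have "compact (PiE UNIV (\<lambda>i. {0..real i}))"
    by (simp add: euclidean_product_topology)
  moreover have "profile_box n a b \<subseteq> PiE UNIV (\<lambda>i. {0..real i})"
    unfolding profile_box_def using profiles_bounds by auto
  ultimately have "compact (profile_box n a b)"
    using closed_profile_box by (metis compact_Int_closed inf.absorb_iff2)
  then obtain c r where cr: "c \<in> profile_box n a b" "strict_mono (r :: nat \<Rightarrow> nat)" "(f \<circ> r) \<longlonglongrightarrow> c"
    using assms unfolding compact_def by blast
  have c: "c \<in> profiles n" and fp: "f k \<in> profiles n" for k
    using cr(1) assms by (auto simp: profile_box_def)
  have lim: "(\<lambda>k. f (r k) i) \<longlonglongrightarrow> c i" for i
    using continuous_on_tendsto_compose[OF continuous_on_product_coordinates[where i=i] cr(3)] by simp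
  \<comment> \<open>The limit lies in the smallest cube of each nearby point, not conversely: near
    an integral coordinate the sequence may approach from either side, while a fractional one keeps
    its unit interval.\<close>
  have near: "\<forall>\<^sub>F k in sequentially. real_of_int \<lfloor>f (r k) i\<rfloor> \<le> c i \<and> c i \<le> of_int \<lceil>f (r k) i\<rceil>" for i
  proof (cases "c i \<in> \<int>")
    case True
    then obtain m where m: "c i = of_int m" by (auto elim: Ints_cases)
    have "\<forall>\<^sub>F k in sequentially. c i - 1 < f (r k) i \<and> f (r k) i < c i + 1"
      using lim[of i] by (intro eventually_conj order_tendstoD[OF lim]) auto
    then show ?thesis
      by eventually_elim (auto simp: m floor_le_iff le_ceiling_iff)
  next
    case False
    then have "of_int \<lfloor>c i\<rfloor> < c i"
      by (metis Ints_of_int less_le of_int_floor_le)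
    moreover have "c i < of_int \<lfloor>c i\<rfloor> + 1" by linarith
    ultimately have "\<forall>\<^sub>F k in sequentially. of_int \<lfloor>c i\<rfloor> < f (r k) i \<and> f (r k) i < of_int \<lfloor>c i\<rfloor> + 1"
      by (intro eventually_conj order_tendstoD[OF lim])
    then show ?thesis
    proof eventually_elim
      case (elim k)
      then have "\<lfloor>f (r k) i\<rfloor> = \<lfloor>c i\<rfloor>" "\<lceil>f (r k) i\<rceil> = \<lfloor>c i\<rfloor> + 1" by linarith+
      then show ?case by simp
    qed
  qed
  have "\<forall>\<^sub>F k in sequentially. \<forall>i\<in>{..n}. real_of_int \<lfloor>f (r k) i\<rfloor> \<le> c i \<and> c i \<le> of_int \<lceil>f (r k) i\<rceil>"
    by (intro eventually_ball_finite ballI near) simp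
  then have ev: "\<forall>\<^sub>F k in sequentially. l2 n (f (r k)) c = chain_dist n (f (r k)) c"
  proof eventually_elim
    case (elim k)
    have "real_of_int \<lfloor>f (r k) i\<rfloor> \<le> c i \<and> c i \<le> of_int \<lceil>f (r k) i\<rceil>" for i
      using elim profiles_zero(2)[OF c, of i] profiles_zero(2)[OF fp, of i] by (cases "i \<le> n") auto
    then have "cell_adjacent n (f (r k)) c"
      unfolding cell_adjacent_def using rounding_cell[OF fp, of "r k"]
      by (intro exI[of _ "\<lambda>i. of_int \<lfloor>f (r k) i\<rfloor>"] exI[of _ "\<lambda>i. of_int \<lceil>f (r k) i\<rceil>"]) (auto simp: box_fun_def)
    then show ?case using chain_dist_adjacent by metis
  qed
  have "(\<lambda>k. l2 n (f (r k)) c) \<longlonglongrightarrow> 0"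
  proof -
    have "(\<lambda>k. sqrt (\<Sum>i\<le>n. (f (r k) i - c i)\<^sup>2)) \<longlonglongrightarrow> sqrt (\<Sum>i\<le>n. (c i - c i)\<^sup>2)"
      by (intro tendsto_intros lim)
    then show ?thesis by (simp add: l2_def L2_set_def)
  qed
  then have "(\<lambda>k. chain_dist n (f (r k)) c) \<longlonglongrightarrow> 0"
    using ev by (rule Lim_transform_eventually)
  with cr that show thesis by blast
qed

section \<open>Boxes of profiles satisfy the Bruhat--Tits inequality\<close>

lemma CN_space_cell:
  assumes c: "cell n a b"
  shows "CN_space (profile_box n a b) (chain_dist n)"
  unfolding CN_space_def
proof (intro ballI)
  fix q r and t :: real assume q: "q \<in> profile_box n a b" and r: "r \<in> profile_box n a b" and t: "t \<in> {0..1}"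
  have pb: "profile_box n a b = box_fun a b"
    unfolding profile_box_def using cell_box_profiles[OF c] by blast
  have dist: "chain_dist n x y = l2 n x y" if "x \<in> profile_box n a b" "y \<in> profile_box n a b" for x y
    using c that unfolding pb by (intro chain_dist_adjacent) (auto simp: cell_adjacent_def)
  define m where "m = (\<lambda>i. (1 - t) * q i + t * r i)"
  have m: "m \<in> profile_box n a b"
    unfolding pb box_fun_def
  proof (intro CollectI allI)
    fix i
    have "a i \<le> q i" "q i \<le> b i" "a i \<le> r i" "r i \<le> b i"
      using q r box_funD unfolding pb by blast+
    then have "q i \<in> {a i..b i}" "r i \<in> {a i..b i}" by auto
    then have "(1 - t) *\<^sub>R q i + t *\<^sub>R r i \<in> {a i..b i}"
      using t convexD_alt[OF convex_real_interval(5)] by auto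
    then show "a i \<le> m i \<and> m i \<le> b i" by (simp add: m_def)
  qed
  have "CN_point (chain_dist n) (profile_box n a b) q r t m"
    unfolding CN_point_def
  proof (intro conjI m ballI)
    fix p assume p: "p \<in> profile_box n a b"
    have "(l2 n p m)\<^sup>2 = (\<Sum>i\<le>n. (1 - t) * (p i - q i)\<^sup>2 + t * (p i - r i)\<^sup>2 - t * (1 - t) * (q i - r i)\<^sup>2)"
      unfolding l2_squared by (rule sum.cong) (auto simp: m_def power2_eq_square algebra_simps)
    also have "\<dots> = (1 - t) * (l2 n p q)\<^sup>2 + t * (l2 n p r)\<^sup>2 - t * (1 - t) * (l2 n q r)\<^sup>2"
      by (simp only: l2_squared sum_subtractf sum.distrib sum_distrib_left)
    finally show "(chain_dist n p m)\<^sup>2 \<le>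
       (1 - t) * (chain_dist n p q)\<^sup>2 + t * (chain_dist n p r)\<^sup>2 - t * (1 - t) * (chain_dist n q r)\<^sup>2"
      using dist p q r m by simp
  qed
  then show "\<exists>m. CN_point (chain_dist n) (profile_box n a b) q r t m" by blast
qed

text \<open>
  A chain from \<open>x\<close> to \<open>z\<close>, once clamped into the box, changes sides at one of its vertices;
  compactness turns this into a point of the common part on a shortest path.
\<close>

lemma chain_dist_through:
  assumes ab: "a \<in> integral_profiles n" "b \<in> integral_profiles n" "\<And>i. a i \<le> b i"
    and ab': "\<And>i. a i \<le> a' i" "\<And>i. b' i \<le> b i"
    and cover: "profile_box n a b \<subseteq> profile_box n a b' \<union> profile_box n a' b"
    and cross: "\<And>x y. x \<in> profile_box n a b' \<Longrightarrow> y \<in> profile_box n a' b \<Longrightarrow> cell_adjacent n x y \<Longrightarrow>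
      x \<in> profile_box n a' b \<or> y \<in> profile_box n a b'"
    and x: "x \<in> profile_box n a b'" and z: "z \<in> profile_box n a' b"
  shows "\<exists>c\<in>profile_box n a' b'. chain_dist n x z = chain_dist n x c + chain_dist n c z"
proof -
  interpret Metric_space "profiles n" "chain_dist n" by (rule chain_dist_metric)
  let ?d = "chain_dist n" and ?c = "clamp_fun a b"
  have Int: "u \<in> profile_box n a' b'" if "u \<in> profile_box n a b'" "u \<in> profile_box n a' b" for u
    using that by (auto simp: profile_box_def box_fun_def)
  have prof: "?c u \<in> profiles n" "?c u \<in> profile_box n a b" if "u \<in> profiles n" for u
    using clamp_fun_profile_box[OF ab that] by (auto simp: profile_box_def)
  have boxp: "u \<in> profiles n" if "u \<in> profile_box n lo hi" for u lo hi
    using that by (simp add: profile_box_def)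
  have crossing: "\<exists>c\<in>profile_box n a' b'. ?d (?c x) c + ?d c (?c z) \<le> l"
    if "chain n x l z" "?c x \<in> profile_box n a b'" "?c z \<in> profile_box n a' b" for x l z
    using that
  proof (induction rule: chain.induct)
    case (refl x)
    then show ?case using Int prof by (intro bexI[of _ "?c x"]) auto
  next
    case (step x y l z)
    have p: "x \<in> profiles n" "y \<in> profiles n" "z \<in> profiles n"
      using step cell_adjacent_profiles chain_profiles by blast+
    have adj: "cell_adjacent n (?c x) (?c y)"
      by (rule clamp_fun_adjacent[OF ab(1,2) step(1)])
    have xy: "?d (?c x) (?c y) \<le> l2 n x y"
      using chain_dist_adjacent[OF adj] l2_clamp_fun by metis
    show ?case
    proof (cases "?c y \<in> profile_box n a b'")
      case True
      then obtain c where c: "c \<in> profile_box n a' b'" "?d (?c y) c + ?d c (?c z) \<le> l"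
        using step by blast
      have "?d (?c x) c \<le> ?d (?c x) (?c y) + ?d (?c y) c"
        using p prof boxp[OF c(1)] by (intro triangle) auto
      then show ?thesis using c xy by (intro bexI[of _ c]) linarith+
    next
      \<comment> \<open>The first step that leaves the piece below \<open>b'\<close>: by
        \<open>cross\<close> it starts in the common part.\<close>
      case False
      then have "?c y \<in> profile_box n a' b"
        using cover prof(2)[OF p(2)] by blast
      then have "?c x \<in> profile_box n a' b'"
        using cross adj step.prems False Int by blast
      moreover have "?d (?c x) (?c z) \<le> ?d (?c x) (?c y) + ?d (?c y) (?c z)"
        using p prof by (intro triangle) auto
      moreover have "?d (?c y) (?c z) \<le> l"
        by (rule chain_dist_clamp_fun[OF ab(1,2) step(2)])
      ultimately show ?thesis
        using xy prof p by (intro bexI[of _ "?c x"]) auto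
    qed
  qed
  have xz: "?c x = x" "?c z = z"
    using x z ab' by (auto intro!: clamp_fun_box simp: profile_box_def box_fun_def) (meson order_trans)+
  have pxz: "x \<in> profiles n" "z \<in> profiles n" using x z boxp by blast+
  have "\<exists>c\<in>profile_box n a' b'. ?d x c + ?d c z < ?d x z + 1 / real (Suc k)" for k
  proof -
    obtain l where "chain n x l z" "l < ?d x z + 1 / real (Suc k)"
      using chain_dist_approx[OF pxz, of "1 / real (Suc k)"] by auto
    then show ?thesis
      using crossing[of x l z] xz x z by (metis order_le_less_trans)
  qed
  then obtain f where f: "\<And>k. f k \<in> profile_box n a' b'" "\<And>k. ?d x (f k) + ?d (f k) z < ?d x z + 1 / real (Suc k)"
    by metis
  obtain r c where rc: "strict_mono (r :: nat \<Rightarrow> nat)" "c \<in> profile_box n a' b'" "(\<lambda>k. ?d (f (r k)) c) \<longlonglongrightarrow> 0"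
    by (rule profile_box_subseq[OF f(1)])
  have cp: "c \<in> profiles n" and fp: "f k \<in> profiles n" for k using rc f boxp by blast+
  have bound: "?d x c + ?d c z \<le> ?d x z + 1 / real (Suc k) + 2 * ?d (f (r k)) c" for k
  proof -
    have "?d x c \<le> ?d x (f (r k)) + ?d (f (r k)) c"
      using triangle[OF pxz(1) fp cp] .
    moreover have "?d c z \<le> ?d (f (r k)) c + ?d (f (r k)) z"
      using triangle[OF cp fp pxz(2)] by (simp add: commute[of c])
    moreover have "1 / real (Suc (r k)) \<le> 1 / real (Suc k)"
      using seq_suble[OF rc(1), of k] by (intro divide_left_mono) auto
    ultimately show ?thesis using f(2)[of "r k"] by linarith
  qed
  have "(\<lambda>k. ?d x z + 1 / real (Suc k) + 2 * ?d (f (r k)) c) \<longlonglongrightarrow> ?d x z + 0 + 2 * 0"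
    by (intro tendsto_intros rc(3) LIMSEQ_Suc[OF lim_1_over_n])
  then have "?d x c + ?d c z \<le> ?d x z + 0 + 2 * 0"
    by (rule LIMSEQ_le_const) (use bound in blast)
  moreover have "?d x z \<le> ?d x c + ?d c z" using triangle pxz cp by blast
  ultimately show ?thesis using rc(2) by (intro bexI[of _ c]) auto
qed

lemma CN_space_split:
  assumes ab: "a \<in> integral_profiles n" "b \<in> integral_profiles n" "\<And>i. a i \<le> b i"
    and ab': "\<And>i. a i \<le> a' i" "\<And>i. b' i \<le> b i"
    and cover: "profile_box n a b \<subseteq> profile_box n a b' \<union> profile_box n a' b"
    and cross: "\<And>x y. x \<in> profile_box n a b' \<Longrightarrow> y \<in> profile_box n a' b \<Longrightarrow> cell_adjacent n x y \<Longrightarrow>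
      x \<in> profile_box n a' b \<or> y \<in> profile_box n a b'"
    and CN: "CN_space (profile_box n a b') (chain_dist n)" "CN_space (profile_box n a' b) (chain_dist n)"
      "CN_space (profile_box n a' b') (chain_dist n)"
  shows "CN_space (profile_box n a b) (chain_dist n)"
proof -
  have Int: "profile_box n a b' \<inter> profile_box n a' b = profile_box n a' b'"
    unfolding profile_box_def box_fun_def using ab' by (auto; meson order_trans)
  have "profile_box n a b' \<union> profile_box n a' b \<subseteq> profile_box n a b"
    unfolding profile_box_def box_fun_def using ab' by (auto; meson order_trans)
  with cover have Un: "profile_box n a b' \<union> profile_box n a' b = profile_box n a b" by blast
  interpret CN_gluing "profiles n" "chain_dist n" "profile_box n a b'" "profile_box n a' b"
  proof (intro CN_gluing.intro chain_dist_metric CN_gluing_axioms.intro)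
    show "\<exists>c\<in>profile_box n a b' \<inter> profile_box n a' b. chain_dist n x z = chain_dist n x c + chain_dist n c z"
      if "x \<in> profile_box n a b'" "z \<in> profile_box n a' b" for x z
      unfolding Int by (rule chain_dist_through[OF ab ab' cover cross that])
  qed (use CN Int in \<open>auto simp: profile_box_def\<close>)
  show ?thesis using CN_space_Un Un by simp
qed

text \<open>For \<open>0 \<le> k \<le> i \<le> n\<close>, the formula under the minimum is the
  greatest profile with height at most \<open>k\<close> at position \<open>i\<close>: slope 1 up to
  height \<open>k\<close>, flat until \<open>i\<close>, slope 1 afterwards. Its mirror image in
  \<open>lower_cut\<close> is the least profile that reaches \<open>k\<close> at \<open>i\<close>.
  Bounding just one coordinate would not give integral profiles as corners, which clamping
  requires.\<close>

definition upper_cut :: "nat \<Rightarrow> (nat \<Rightarrow> real) \<Rightarrow> nat \<Rightarrow> real \<Rightarrow> nat \<Rightarrow> real" where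
  "upper_cut n b i k = (\<lambda>j. min (b j) (if j \<le> n then min (real j) k + max 0 (real j - real i) else 0))"

definition lower_cut :: "nat \<Rightarrow> (nat \<Rightarrow> real) \<Rightarrow> nat \<Rightarrow> real \<Rightarrow> nat \<Rightarrow> real" where
  "lower_cut n a i k = (\<lambda>j. max (a j) (if j \<le> n then max 0 (k - max 0 (real i - real j)) else 0))"

lemma upper_cut_integral:
  assumes "b \<in> integral_profiles n" "k \<in> \<int>" "0 \<le> k" "k \<le> real i"
  shows "upper_cut n b i k \<in> integral_profiles n"
  unfolding upper_cut_def
proof (intro min_integral_profiles assms(1) integral_profilesI)
  show "(if j \<le> n then min (real j) k + max 0 (real j - real i) else 0) \<in> \<int>" for j
    using assms(2) by (auto simp: min_def max_def)
  fix j assume "j < n"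
  have "real (Suc j) \<le> real i \<or> real i \<le> real j" by (cases "j < i") auto
  moreover have "real j < k \<longrightarrow> real (Suc j) \<le> k"
    using Ints_less_le[of "real j" k] assms(2) by auto
  ultimately show "(if j \<le> n then min (real j) k + max 0 (real j - real i) else 0)
    \<le> (if Suc j \<le> n then min (real (Suc j)) k + max 0 (real (Suc j) - real i) else 0) \<and>
    (if Suc j \<le> n then min (real (Suc j)) k + max 0 (real (Suc j) - real i) else 0)
    \<le> (if j \<le> n then min (real j) k + max 0 (real j - real i) else 0) + 1"
    using \<open>j < n\<close> assms(3,4) by (auto simp: min_def max_def)
qed (use assms in auto)

lemma lower_cut_integral:
  assumes "a \<in> integral_profiles n" "k \<in> \<int>" "0 \<le> k" "k \<le> real i" "i \<le> n"
  shows "lower_cut n a i k \<in> integral_profiles n"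
  unfolding lower_cut_def
proof (intro max_integral_profiles assms(1) integral_profilesI)
  show "(if j \<le> n then max 0 (k - max 0 (real i - real j)) else 0) \<in> \<int>" for j
    using assms(2) by (auto simp: max_def)
  fix j assume "j < n"
  have "real (Suc j) \<le> real i \<or> real i \<le> real j" by (cases "j < i") auto
  then show "(if j \<le> n then max 0 (k - max 0 (real i - real j)) else 0)
    \<le> (if Suc j \<le> n then max 0 (k - max 0 (real i - real (Suc j))) else 0) \<and>
    (if Suc j \<le> n then max 0 (k - max 0 (real i - real (Suc j))) else 0)
    \<le> (if j \<le> n then max 0 (k - max 0 (real i - real j)) else 0) + 1"
    using \<open>j < n\<close> by (auto simp: max_def)
qed (use assms in auto)

text \<open>The bounds at other positions cost nothing: they follow from the bound at
  \<open>i\<close>, since slopes of profiles lie between 0 and 1.\<close>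

lemma profile_box_upper_cut:
  assumes "i \<le> n" "0 \<le> k" "k \<le> real i"
  shows "profile_box n a (upper_cut n b i k) = {H \<in> profile_box n a b. H i \<le> k}"
proof -
  define M where "M j = (if j \<le> n then min (real j) k + max 0 (real j - real i) else 0)" for j
  have le: "H j \<le> M j" if "H \<in> profiles n" "H i \<le> k" for H j
    using profiles_slope[OF that(1), of i j] profiles_slope[OF that(1), of j i] profiles_bounds[OF that(1), of j]
      profiles_zero(2)[OF that(1), of j] that(2) assms unfolding M_def by (cases "j \<le> i") (auto simp: max_def)
  have M: "M i = k" using assms by (simp add: M_def)
  have "upper_cut n b i k = (\<lambda>j. min (b j) (M j))"
    unfolding upper_cut_def M_def ..
  then have "profile_box n a (upper_cut n b i k) = {H \<in> profile_box n a b. \<forall>j. H j \<le> M j}"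
    unfolding profile_box_def box_fun_def by auto
  also have "\<dots> = {H \<in> profile_box n a b. H i \<le> k}"
    using le M by (auto simp: profile_box_def)
  finally show ?thesis .
qed

lemma profile_box_lower_cut:
  assumes "i \<le> n"
  shows "profile_box n (lower_cut n a i k) b = {H \<in> profile_box n a b. k \<le> H i}"
proof -
  define M where "M j = (if j \<le> n then max 0 (k - max 0 (real i - real j)) else 0)" for j
  have le: "M j \<le> H j" if "H \<in> profiles n" "k \<le> H i" for H j
    using profiles_slope[OF that(1), of i j] profiles_slope[OF that(1), of j i] profiles_bounds[OF that(1), of j]
      profiles_zero(2)[OF that(1), of j] that(2) assms unfolding M_def by (cases "j \<le> i") (auto simp: max_def)
  have M: "k \<le> M i" using assms by (simp add: M_def)
  have "lower_cut n a i k = (\<lambda>j. max (a j) (M j))"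
    unfolding lower_cut_def M_def ..
  then have "profile_box n (lower_cut n a i k) b = {H \<in> profile_box n a b. \<forall>j. M j \<le> H j}"
    unfolding profile_box_def box_fun_def by auto
  also have "\<dots> = {H \<in> profile_box n a b. k \<le> H i}"
    using le M by (auto simp: profile_box_def) (meson order_trans)
  finally show ?thesis .
qed

lemma CN_space_profile_box_sum:
  assumes "a \<in> integral_profiles n" "b \<in> integral_profiles n" "(\<Sum>i\<le>n. b i - a i) \<le> real N"
  shows "CN_space (profile_box n a b) (chain_dist n)"
  using assms
proof (induction N arbitrary: a b)
  case 0
  show ?case
  proof (cases "\<forall>i. a i \<le> b i")
    case True
    have "b i - a i = 0" if "i \<le> n" for i
      using 0(3) True sum_nonneg_eq_0_iff[of "{..n}" "\<lambda>i. b i - a i"] sum_nonneg[of "{..n}" "\<lambda>i. b i - a i"] that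
      by force
    then have "b i = a i" for i
      using profiles_zero(2)[OF integral_profilesD(1)[OF 0(1)]] profiles_zero(2)[OF integral_profilesD(1)[OF 0(2)]]
      by (cases "i \<le> n") auto
    then show ?thesis
      using 0 by (intro CN_space_cell) (simp add: cell_def)
  next
    case False
    then have "profile_box n a b = {}"
      unfolding profile_box_def box_fun_def by (auto; meson order_trans)
    then show ?thesis by (simp add: CN_space_def)
  qed
next
  case (Suc N)
  note aZ = integral_profilesD(2)[OF Suc.prems(1)] and bZ = integral_profilesD(2)[OF Suc.prems(2)]
  note ap = integral_profilesD(1)[OF Suc.prems(1)] and bp = integral_profilesD(1)[OF Suc.prems(2)]
  \<comment> \<open>One scheme for both kinds of cut, into the parts \<open>H i \<le> k\<close> and
    \<open>l \<le> H j\<close>. A cut at an integral hyperplane has \<open>i = j\<close> and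
    \<open>k = l\<close>; a cut at a corner uses neighbouring positions. The strict inequalities
    make both parts smaller by at least one unit of side length.\<close>
  have cut: "CN_space (profile_box n a b) (chain_dist n)"
    if le: "\<And>i. a i \<le> b i" and i: "i \<le> n" "k \<in> \<int>" "a i \<le> k" "k < b i"
      and j: "j \<le> n" "l \<in> \<int>" "a j < l" "l \<le> b j"
      and cover: "\<And>H. H \<in> profile_box n a b \<Longrightarrow> H i \<le> k \<or> l \<le> H j"
      and cross: "\<And>x y. cell_adjacent n x y \<Longrightarrow> x \<in> profile_box n a b \<Longrightarrow> y \<in> profile_box n a b \<Longrightarrow>
        x i \<le> k \<Longrightarrow> l \<le> y j \<Longrightarrow> l \<le> x j \<or> y i \<le> k" for i j k l
  proof -
    define a' where "a' = lower_cut n a j l"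
    define b' where "b' = upper_cut n b i k"
    have k: "0 \<le> k" "k \<le> real i" and l: "0 \<le> l" "l \<le> real j"
      using profiles_bounds[OF ap, of i] profiles_bounds[OF bp, of i]
        profiles_bounds[OF ap, of j] profiles_bounds[OF bp, of j] i j by linarith+
    have U: "profile_box n a b' = {H \<in> profile_box n a b. H i \<le> k}"
      unfolding b'_def by (rule profile_box_upper_cut[OF i(1) k])
    have W: "profile_box n a' b = {H \<in> profile_box n a b. l \<le> H j}"
      unfolding a'_def by (rule profile_box_lower_cut[OF j(1)])
    have a': "a' \<in> integral_profiles n" and b': "b' \<in> integral_profiles n"
      unfolding a'_def b'_def using lower_cut_integral upper_cut_integral Suc.prems i j k l by blast+
    have aa: "a i \<le> a' i" and bb: "b' i \<le> b i" for i
      by (auto simp: a'_def b'_def lower_cut_def upper_cut_def)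
    have "a \<in> profile_box n a b" "b \<in> profile_box n a b"
      using ap bp le by (auto simp: profile_box_def box_fun_def)
    have b'i: "b' i + 1 \<le> b i"
      using i k Ints_less_le[OF i(2) bZ i(4)] by (auto simp: b'_def upper_cut_def)
    have a'j: "a j + 1 \<le> a' j"
      using j l Ints_less_le[OF aZ j(2,3)] by (auto simp: a'_def lower_cut_def)
    have sb: "(\<Sum>i\<le>n. b' i - a i) \<le> real N"
    proof -
      have "(\<Sum>j\<le>n. b' j - a j) \<le> (\<Sum>j\<le>n. b j - a j - (if j = i then 1 else 0))"
        using bb b'i by (intro sum_mono) auto
      also have "\<dots> = (\<Sum>j\<le>n. b j - a j) - 1" using i(1) by (simp add: sum_subtractf)
      finally show ?thesis using Suc.prems by simp
    qed
    have sa: "(\<Sum>i\<le>n. b i - a' i) \<le> real N"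
    proof -
      have "(\<Sum>i\<le>n. b i - a' i) \<le> (\<Sum>i\<le>n. b i - a i - (if i = j then 1 else 0))"
        using aa a'j by (intro sum_mono) auto
      also have "\<dots> = (\<Sum>j\<le>n. b j - a j) - 1" using j(1) by (simp add: sum_subtractf)
      finally show ?thesis using Suc.prems by simp
    qed
    have "(\<Sum>i\<le>n. b' i - a' i) \<le> (\<Sum>i\<le>n. b' i - a i)"
      using aa by (intro sum_mono) auto
    then have sab: "(\<Sum>i\<le>n. b' i - a' i) \<le> real N" using sb by linarith
    show ?thesis
    proof (rule CN_space_split[OF Suc.prems(1,2) le aa bb])
      show "profile_box n a b \<subseteq> profile_box n a b' \<union> profile_box n a' b"
        unfolding U W using cover by blast
      show "x \<in> profile_box n a' b \<or> y \<in> profile_box n a b'"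
        if "x \<in> profile_box n a b'" "y \<in> profile_box n a' b" "cell_adjacent n x y" for x y
        using that cross[of x y] unfolding U W by blast
      show "CN_space (profile_box n a b') (chain_dist n)" by (rule Suc.IH[OF Suc.prems(1) b' sb])
      show "CN_space (profile_box n a' b) (chain_dist n)" by (rule Suc.IH[OF a' Suc.prems(2) sa])
      show "CN_space (profile_box n a' b') (chain_dist n)" by (rule Suc.IH[OF a' b' sab])
    qed
  qed
  have small: "i \<le> n" if "a i < b i" for i
    using that profiles_zero(2)[OF ap, of i] profiles_zero(2)[OF bp, of i] by (metis less_irrefl not_le)
  consider "\<not> (\<forall>i. a i \<le> b i)" | "cell n a b"
    | i where "\<forall>i. a i \<le> b i" "a i + 1 < b i"
    | i where "\<forall>i. a i \<le> b i" "\<forall>i. b i \<le> a i + 1" "i < n" "a i < b i" "a (Suc i) < b (Suc i)"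
    unfolding cell_def using Suc.prems by (metis less_le not_le)
  then show ?case
  proof cases
    case 1
    then have "profile_box n a b = {}"
      unfolding profile_box_def box_fun_def by (auto; meson order_trans)
    then show ?thesis by (simp add: CN_space_def)
  next
    case 2
    then show ?thesis by (rule CN_space_cell)
  next
    case (3 i)
    have i: "i \<le> n" using 3 small[of i] by simp
    \<comment> \<open>A long side is cut at the integral level \<open>a i + 1\<close>; no cube has
      this level strictly between its corners.\<close>
    show ?thesis
    proof (rule cut[of i "a i + 1" i "a i + 1"])
      fix x y assume "cell_adjacent n x y" "x i \<le> a i + 1" "a i + 1 \<le> y i"
      then obtain lo hi where c: "cell n lo hi" "x \<in> box_fun lo hi" "y \<in> box_fun lo hi"
        unfolding cell_adjacent_def by blast
      have "lo i = a i + 1 \<or> hi i = a i + 1 \<or> hi i < a i + 1 \<or> a i + 1 < lo i"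
        using Ints_le_cases[of "lo i" "a i + 1"] cellD(1,2)[OF c(1), of i]
          integral_profilesD(2)[OF cell_integral(1)[OF c(1)], of i] aZ[of i] by force
      then show "a i + 1 \<le> x i \<or> y i \<le> a i + 1"
        using box_funD[OF c(2), of i] box_funD[OF c(3), of i] \<open>x i \<le> a i + 1\<close> \<open>a i + 1 \<le> y i\<close> by linarith
    qed (use 3 i aZ in auto)
  next
    case (4 i)
    have b: "b i = a i + 1" "b (Suc i) = a (Suc i) + 1"
      using 4 Ints_le_cases[OF aZ bZ, of i i] Ints_le_cases[OF aZ bZ, of "Suc i" "Suc i"] by force+
    have a: "a (Suc i) = a i \<or> a (Suc i) = a i + 1"
      using unit_step_Ints[OF aZ aZ] profiles_step[OF ap 4(3)] by blast
    have step: "unit_step (H i) (H (Suc i))" "a i \<le> H i" "H i \<le> a i + 1" "a (Suc i) \<le> H (Suc i)" "H (Suc i) \<le> a (Suc i) + 1"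
      if "H \<in> profile_box n a b" for H
      using that profiles_step[OF _ 4(3), of H] box_funD[of H a b i] box_funD[of H a b "Suc i"] b
      by (auto simp: profile_box_def)
    have adj: "x i = y i \<or> x (Suc i) = y (Suc i)" if xy: "cell_adjacent n x y" for x y
    proof -
      obtain lo hi where "cell n lo hi" "x \<in> box_fun lo hi" "y \<in> box_fun lo hi"
        using xy unfolding cell_adjacent_def by blast
      then show ?thesis using cellD(3)[of n lo hi i] 4(3) box_funD by (metis order_antisym)
    qed
    from a show ?thesis
    proof
      \<comment> \<open>The staircase runs through \<open>H i = a i\<close>, then
        \<open>H (Suc i) = a i + 1\<close>. Points of one cube agree in one of the two coordinates,
        so a cube cannot jump across the corner.\<close>
      assume a: "a (Suc i) = a i"
      show ?thesis
      proof (rule cut[of i "a i" "Suc i" "a i + 1"])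
        fix H assume H: "H \<in> profile_box n a b"
        show "H i \<le> a i \<or> a i + 1 \<le> H (Suc i)"
          using unit_step_corner(1)[OF aZ, of "H i" "H (Suc i)" i] step[OF H] a by simp
        show "a i + 1 \<le> x (Suc i) \<or> y i \<le> a i"
          if "cell_adjacent n x y" "x i \<le> a i" "a i + 1 \<le> y (Suc i)" for x y
          using adj[OF that(1)] that by auto
      qed (use 4 a b aZ in auto)
    next
      \<comment> \<open>The other turn: the staircase runs through
        \<open>H (Suc i) = a i + 1\<close>, then \<open>H i = a i + 1\<close>.\<close>
      assume a: "a (Suc i) = a i + 1"
      show ?thesis
      proof (rule cut[of "Suc i" "a i + 1" i "a i + 1"])
        fix H assume H: "H \<in> profile_box n a b"
        show "H (Suc i) \<le> a i + 1 \<or> a i + 1 \<le> H i"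
          using unit_step_corner(2)[OF aZ, of "H i" "H (Suc i)" i] step[OF H] a by simp
        show "a i + 1 \<le> x i \<or> y (Suc i) \<le> a i + 1"
          if "cell_adjacent n x y" "x (Suc i) \<le> a i + 1" "a i + 1 \<le> y i" for x y
          using adj[OF that(1)] that by auto
      qed (use 4 a b aZ in auto)
    qed
  qed
qed

theorem CN_space_profiles: "CN_space (profiles n) (chain_dist n)"
proof -
  let ?b = "\<lambda>i. if i \<le> n then real i else 0"
  have "?b \<in> integral_profiles n" "(\<lambda>_. 0) \<in> integral_profiles n"
    by (intro integral_profilesI; simp)+
  moreover have "(\<Sum>i\<le>n. ?b i - 0) \<le> real (nat \<lceil>\<Sum>i\<le>n. ?b i - 0\<rceil>)"
    by linarith
  ultimately have "CN_space (profile_box n (\<lambda>_. 0) ?b) (chain_dist n)"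
    by (intro CN_space_profile_box_sum) auto
  moreover have "profile_box n (\<lambda>_. 0) ?b = profiles n"
    unfolding profile_box_def box_fun_def using profiles_bounds[of _ n] profiles_zero(2)[of _ n]
    by (auto; metis order_refl not_le)
  ultimately show ?thesis by simp
qed

section \<open>The state complex as a complex of profiles\<close>

definition height :: "nat \<Rightarrow> nat set \<Rightarrow> nat \<Rightarrow> real" where
  "height n A i = (if i \<le> n then real (card (A \<inter> {1..i})) else 0)"

lemma height_0 [simp]: "height n A 0 = 0"
  by (simp add: height_def)

lemma height_Suc:
  assumes "i < n"
  shows "height n A (Suc i) = height n A i + of_bool (Suc i \<in> A)"
proof -
  have "A \<inter> {1..Suc i} = (if Suc i \<in> A then insert (Suc i) (A \<inter> {1..i}) else A \<inter> {1..i})"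
    by (auto simp: le_Suc_eq)
  then show ?thesis using assms by (simp add: height_def)
qed

lemma height_beyond: "n < i \<Longrightarrow> height n A i = 0"
  by (simp add: height_def)

lemma height_integral_profile: "height n A \<in> integral_profiles n"
  by (rule integral_profilesI) (auto simp: height_Suc height_beyond, auto simp: height_def)

lemma height_inj:
  assumes "A \<subseteq> {1..n}" "B \<subseteq> {1..n}" "height n A = height n B"
  shows "A = B"
proof -
  have "j \<in> A \<longleftrightarrow> j \<in> B" if j: "j \<in> {1..n}" for j
  proof -
    obtain i where "j = Suc i" "i < n" using j by (cases j) auto
    then show ?thesis
      using height_Suc[of i n A] height_Suc[of i n B] assms(3) by (auto simp: of_bool_def split: if_splits)
  qed
  then show ?thesis using assms by blast
qed

lemma height_surj:
  assumes "h \<in> integral_profiles n"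
  obtains A where "A \<subseteq> {1..n}" "height n A = h"
proof -
  note hp = integral_profilesD(1)[OF assms] and hZ = integral_profilesD(2)[OF assms]
  define A where "A = {i \<in> {1..n}. h i \<noteq> h (i - 1)}"
  have "height n A i = h i" if "i \<le> n" for i
    using that
  proof (induction i)
    case 0
    then show ?case using profiles_zero[OF hp] by simp
  next
    case (Suc i)
    then have "h (Suc i) = h i \<or> h (Suc i) = h i + 1"
      using unit_step_Ints[OF hZ hZ] profiles_step[OF hp, of i] by auto
    then show ?case
      using Suc height_Suc[of i n A] by (auto simp: A_def)
  qed
  then have "height n A = h"
    using profiles_zero(2)[OF hp] height_beyond by (metis ext not_le)
  moreover have "A \<subseteq> {1..n}" by (auto simp: A_def)
  ultimately show thesis using that by blast
qed

text \<open>
  On each cube these tent products restrict to the multilinear weights of \<open>cube_point\<close>, so that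
  one formula describes the points of all cubes.
\<close>

definition weights :: "nat \<Rightarrow> (nat \<Rightarrow> real) \<Rightarrow> nat set \<Rightarrow> real" where
  "weights n H v = (if v \<subseteq> {1..n} then \<Prod>i\<in>{1..n}. max 0 (1 - \<bar>H i - height n v i\<bar>) else 0)"

lemma weights_pos_iff:
  assumes "v \<subseteq> {1..n}"
  shows "0 < weights n H v \<longleftrightarrow> (\<forall>i\<in>{1..n}. \<bar>H i - height n v i\<bar> < 1)"
proof
  assume "0 < weights n H v"
  moreover have "weights n H v = (\<Prod>i\<in>{1..n}. max 0 (1 - \<bar>H i - height n v i\<bar>))"
    using assms by (simp only: weights_def if_True)
  ultimately have "(\<Prod>i\<in>{1..n}. max 0 (1 - \<bar>H i - height n v i\<bar>)) \<noteq> 0"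
    by (metis less_irrefl)
  then have "max 0 (1 - \<bar>H i - height n v i\<bar>) \<noteq> 0" if "i \<in> {1..n}" for i
    using that by (meson finite_atLeastAtMost prod_zero)
  then show "\<forall>i\<in>{1..n}. \<bar>H i - height n v i\<bar> < 1"
    by (force simp: max_def split: if_splits)
qed (use assms in \<open>auto simp: weights_def intro!: prod_pos\<close>)

text \<open>The states of positive weight are those whose heights differ from the profile by less
  than 1 everywhere, so equal weights mean the same nearby states.\<close>

lemma weights_profile_support:
  assumes H: "H \<in> profiles n" and K: "K \<in> profiles n" and eq: "weights n H = weights n K"
    and h: "h \<in> integral_profiles n" "\<And>i. \<bar>H i - h i\<bar> < 1"
  shows "\<bar>K i - h i\<bar> < 1"
proof -
  obtain v where v: "v \<subseteq> {1..n}" "height n v = h" using height_surj[OF h(1)] .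
  then have "0 < weights n K v"
    using weights_pos_iff[OF v(1), of H] h(2) eq by auto
  then have "\<forall>i\<in>{1..n}. \<bar>K i - h i\<bar> < 1"
    using weights_pos_iff[OF v(1)] v by auto
  moreover have "\<bar>K i - h i\<bar> < 1" if "i \<notin> {1..n}"
  proof -
    have "i = 0 \<or> n < i" using that by auto
    then show ?thesis
      using profiles_zero[OF K] profiles_zero[OF integral_profilesD(1)[OF h(1)]] by auto
  qed
  ultimately show ?thesis by blast
qed

text \<open>Equal supports force equal roundings, hence the same smallest cube. A fractional
  coordinate is then read off from two vertices that differ only there, whose weights are in the
  ratio \<open>1 - x\<close> to \<open>x\<close>.\<close>

lemma weights_inj: "inj_on (weights n) (profiles n)"
proof (rule inj_onI)
  fix H K assume H: "H \<in> profiles n" and K: "K \<in> profiles n" and eq: "weights n H = weights n K"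
  have near: "\<bar>K i - of_int \<lfloor>H i\<rfloor>\<bar> < 1" "\<bar>K i - of_int \<lceil>H i\<rceil>\<bar> < 1"
    if "H \<in> profiles n" "K \<in> profiles n" "weights n H = weights n K" for H K i
  proof -
    have "\<bar>H i - of_int \<lfloor>H i\<rfloor>\<bar> < 1" "\<bar>H i - of_int \<lceil>H i\<rceil>\<bar> < 1" for i by linarith+
    then show "\<bar>K i - of_int \<lfloor>H i\<rfloor>\<bar> < 1" "\<bar>K i - of_int \<lceil>H i\<rceil>\<bar> < 1"
      using weights_profile_support[OF that cell_integral(1)[OF rounding_cell(1)[OF that(1)]]]
        weights_profile_support[OF that cell_integral(2)[OF rounding_cell(1)[OF that(1)]]] by blast+
  qed
  have floor: "\<lfloor>H i\<rfloor> = \<lfloor>K i\<rfloor> \<and> \<lceil>H i\<rceil> = \<lceil>K i\<rceil>" for i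
    using near[OF H K eq, of i] near[OF K H eq[symmetric], of i] by linarith
  show "H = K"
  proof
    fix i
    show "H i = K i"
    proof (cases "H i \<in> \<int>")
      case True
      then have "H i = of_int \<lfloor>H i\<rfloor>" "H i = of_int \<lceil>H i\<rceil>" by (auto elim: Ints_cases)
      then have "real_of_int \<lfloor>K i\<rfloor> = of_int \<lceil>K i\<rceil>" using floor[of i] by metis
      then have "K i = of_int \<lfloor>K i\<rfloor>" by linarith
      then show ?thesis using floor[of i] \<open>H i = of_int \<lfloor>H i\<rfloor>\<close> by metis
    next
      case False
      then have "i \<in> {1..n}"
        using profiles_zero[OF H] by (metis Ints_0 One_nat_def Suc_leI atLeastAtMost_iff not_gr_zero not_le)
      define h where "h = (\<lambda>i. real_of_int \<lfloor>H i\<rfloor>)"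
      define h' where "h' = h(i := h i + 1)"
      note c = rounding_cell(1)[OF H]
      have h: "h \<in> integral_profiles n" using cell_integral(1)[OF c] by (simp add: h_def)
      have "real_of_int \<lceil>H i\<rceil> = of_int \<lfloor>H i\<rfloor> + 1"
        using False by (simp add: ceiling_altdef) (metis Ints_of_int)
      then have "h' \<in> box_fun h (\<lambda>i. of_int \<lceil>H i\<rceil>)"
        unfolding box_fun_def h'_def h_def using cellD(1)[OF c] by auto
      then have "h' \<in> profiles n"
        using cell_box_profiles[OF c] by (simp add: h_def)
      then have h': "h' \<in> integral_profiles n"
        using integral_profilesD(2)[OF h] by (simp add: integral_profiles_def h'_def)
      obtain v v' where v: "v \<subseteq> {1..n}" "height n v = h" "v' \<subseteq> {1..n}" "height n v' = h'"
        using height_surj[OF h] height_surj[OF h'] by metis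
      \<comment> \<open>The factor shared by the weights of \<open>v\<close> and \<open>v'\<close>.
        Their sum is \<open>R\<close> itself, so \<open>R\<close> too is determined by the
        weights.\<close>
      define R where "R L = (\<Prod>j\<in>{1..n} - {i}. max 0 (1 - \<bar>L j - h j\<bar>))" for L :: "nat \<Rightarrow> real"
      have w: "weights n L v = (1 - (L i - h i)) * R L \<and> weights n L v' = (L i - h i) * R L \<and> 0 < R L"
        if "\<And>j. \<lfloor>L j\<rfloor> = \<lfloor>H j\<rfloor>" for L
      proof -
        have L: "0 \<le> L j - h j \<and> L j - h j < 1" for j
          using that[of j] unfolding h_def by linarith
        have "weights n L v = max 0 (1 - \<bar>L i - h i\<bar>) * R L"
          unfolding weights_def R_def using v prod.remove[OF _ \<open>i \<in> {1..n}\<close>] by simp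
        moreover have "weights n L v' = max 0 (1 - \<bar>L i - h' i\<bar>) * (\<Prod>j\<in>{1..n} - {i}. max 0 (1 - \<bar>L j - h' j\<bar>))"
          unfolding weights_def using v prod.remove[OF _ \<open>i \<in> {1..n}\<close>] by simp
        moreover have "(\<Prod>j\<in>{1..n} - {i}. max 0 (1 - \<bar>L j - h' j\<bar>)) = R L"
          unfolding R_def h'_def by (rule prod.cong) auto
        moreover have "0 < R L"
          unfolding R_def using L by (intro prod_pos) (auto simp: less_max_iff_disj)
        ultimately show ?thesis using L[of i] by (auto simp: h'_def)
      qed
      have wH: "weights n H v = (1 - (H i - h i)) * R H" "weights n H v' = (H i - h i) * R H" "0 < R H"
        using w[of H] by auto
      have wK: "weights n K v = (1 - (K i - h i)) * R K" "weights n K v' = (K i - h i) * R K"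
        using w[of K] floor by auto
      have "R H = weights n H v + weights n H v'" "R K = weights n K v + weights n K v'"
        unfolding wH wK by (simp_all add: algebra_simps)
      then have "R H = R K" using eq by simp
      then have "(H i - h i) * R H = (K i - h i) * R H"
        using wH(2) wK(2) eq by metis
      then have "(H i - K i) * R H = 0" by (simp add: algebra_simps)
      then show ?thesis using wH(3) by auto
    qed
  qed
qed

section \<open>Cubes of the arm and their faces as boxes of profiles\<close>

definition arm_cube :: "nat \<Rightarrow> nat set \<Rightarrow> nat set \<Rightarrow> bool" where
  "arm_cube n M A \<longleftrightarrow> A \<subseteq> {1..n} \<and> (\<forall>i\<in>M. QR_applicable n A i) \<and> disjoint_family_on (QR_links n) M"

text \<open>The effect of move \<open>i\<close> on the height after \<open>i\<close> links: turning
  a north link east lowers it by one, turning an east link north raises it. This holds for the end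
  flip as well.\<close>

definition direction :: "nat set \<Rightarrow> nat \<Rightarrow> real" where
  "direction A i = (if i \<in> A then - 1 else 1)"

definition cube_profile :: "nat \<Rightarrow> nat set \<Rightarrow> nat set \<Rightarrow> (nat \<Rightarrow> real) \<Rightarrow> nat \<Rightarrow> real" where
  "cube_profile n M A x = (\<lambda>i. height n A i + (if i \<in> M then direction A i * x i else 0))"

lemma QR_state_complex_iff: "C \<in> QR_state_complex n \<longleftrightarrow> (\<exists>M A. C = (M, QR_apply n A) \<and> arm_cube n M A)"
  unfolding QR_state_complex_def arm_cube_def QR_states_def by blast

lemma arm_cube_props:
  assumes "arm_cube n M A"
  shows "A \<subseteq> {1..n}" "M \<subseteq> {1..n}" "finite M" "i \<in> M \<Longrightarrow> Suc i \<notin> M"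
    "i \<in> M \<Longrightarrow> i < n \<Longrightarrow> i \<in> A \<longleftrightarrow> Suc i \<notin> A"
proof -
  show A: "A \<subseteq> {1..n}" and M: "M \<subseteq> {1..n}"
    using assms by (auto simp: arm_cube_def QR_applicable_def)
  show "finite M" using M finite_subset by blast
  show "i \<in> M \<Longrightarrow> i < n \<Longrightarrow> i \<in> A \<longleftrightarrow> Suc i \<notin> A"
    using assms by (auto simp: arm_cube_def QR_applicable_def)
  show "Suc i \<notin> M" if "i \<in> M"
  proof
    assume S: "Suc i \<in> M"
    then have "Suc i \<in> QR_links n i \<inter> QR_links n (Suc i)"
      using M by (auto simp: QR_links_def subset_iff)
    moreover have "QR_links n i \<inter> QR_links n (Suc i) = {}"
      using assms disjoint_family_onD[of "QR_links n" M i "Suc i"] that S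
      by (simp add: arm_cube_def)
    ultimately show False by blast
  qed
qed

lemma QR_apply_subset:
  assumes "arm_cube n M A" "S \<subseteq> M"
  shows "QR_apply n A S \<subseteq> {1..n}"
proof -
  have "S \<subseteq> {1..n}" using arm_cube_props[OF assms(1)] assms(2) by blast
  then show ?thesis
    using arm_cube_props(1)[OF assms(1)] unfolding QR_apply_def QR_links_def
    by (fastforce split: if_splits)
qed

lemma mem_QR_apply:
  assumes "arm_cube n M A" "S \<subseteq> M" "Suc j \<le> n"
  shows "Suc j \<in> QR_apply n A S \<longleftrightarrow> (Suc j \<in> A) \<noteq> (Suc j \<in> S \<or> j \<in> S)"
proof -
  have S: "i \<le> n" if "i \<in> S" for i using arm_cube_props(2)[OF assms(1)] assms(2) that by auto
  have "Suc j \<in> (\<Union>i\<in>S. QR_links n i) \<longleftrightarrow> Suc j \<in> S \<or> j \<in> S"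
  proof
    assume "Suc j \<in> (\<Union>i\<in>S. QR_links n i)"
    then obtain i where "i \<in> S" "Suc j \<in> QR_links n i" by blast
    then show "Suc j \<in> S \<or> j \<in> S" using S[of i] by (auto simp: QR_links_def split: if_splits)
  next
    assume "Suc j \<in> S \<or> j \<in> S"
    then show "Suc j \<in> (\<Union>i\<in>S. QR_links n i)"
    proof
      assume "Suc j \<in> S"
      then show ?thesis using assms(3) by (intro UN_I[of "Suc j"]) (auto simp: QR_links_def)
    next
      assume "j \<in> S"
      then show ?thesis using assms(3) by (intro UN_I[of j]) (auto simp: QR_links_def)
    qed
  qed
  then show ?thesis unfolding QR_apply_def by blast
qed

text \<open>A corner switch turns two opposite links, so its effects cancel after link
  \<open>i + 1\<close> and only the height at \<open>i\<close> changes. The end flip has no later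
  height to affect.\<close>

lemma height_QR_apply:
  assumes "arm_cube n M A" "S \<subseteq> M"
  shows "height n (QR_apply n A S) i = height n A i + (if i \<in> S then direction A i else 0)"
proof (cases "i \<le> n")
  case True
  then show ?thesis
  proof (induction i)
    case 0
    then show ?case using arm_cube_props(2)[OF assms(1)] assms(2) by auto
  next
    case (Suc j)
    have "Suc j \<in> S \<Longrightarrow> j \<notin> S" using arm_cube_props(4)[OF assms(1), of j] assms(2) by blast
    moreover have "j \<in> S \<Longrightarrow> j \<in> A \<longleftrightarrow> Suc j \<notin> A"
      using arm_cube_props(5)[OF assms(1), of j] assms(2) Suc.prems by auto
    ultimately show ?case
      using Suc height_Suc[of j n A] height_Suc[of j n "QR_apply n A S"] mem_QR_apply[OF assms, of j]
      by (auto simp: direction_def)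
  qed
next
  case False
  then show ?thesis
    using arm_cube_props(2)[OF assms(1)] assms(2) by (auto simp: height_beyond)
qed

lemma QR_apply_inj:
  assumes "arm_cube n M A"
  shows "inj_on (QR_apply n A) (Pow M)"
proof (rule inj_onI)
  fix S T assume ST: "S \<in> Pow M" "T \<in> Pow M" "QR_apply n A S = QR_apply n A T"
  have "(if i \<in> S then direction A i else 0) = (if i \<in> T then direction A i else 0)" for i
    using height_QR_apply[OF assms, of S i] height_QR_apply[OF assms, of T i] ST by auto
  then have "i \<in> S \<longleftrightarrow> i \<in> T" for i
    by (smt (verit) direction_def)
  then show "S = T" by blast
qed

text \<open>At the vertex reached by \<open>S\<close>, the tent factor is \<open>x i\<close> on
  \<open>S\<close>, \<open>1 - x i\<close> on the rest of \<open>M\<close>, and 1 elsewhere.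
  Conversely, a state of positive weight is within distance less than 1 in every height, and
  integrality makes it a vertex of the cube.\<close>

lemma cube_point_eq_weights:
  assumes cube: "arm_cube n M A" and x: "\<forall>i\<in>M. x i \<in> {0..1}"
  shows "cube_point (M, QR_apply n A) x = weights n (cube_profile n M A x)"
proof
  fix v
  let ?H = "cube_profile n M A x"
  note M = arm_cube_props(2)[OF cube]
  show "cube_point (M, QR_apply n A) x v = weights n ?H v"
  proof (cases "\<exists>S\<subseteq>M. QR_apply n A S = v")
    case True
    then obtain S where S: "S \<subseteq> M" "QR_apply n A S = v" by blast
    then have "{T. T \<subseteq> M \<and> QR_apply n A T = v} = {S}"
      using QR_apply_inj[OF cube] by (auto dest: inj_onD)
    then have 1: "cube_point (M, QR_apply n A) x v = (\<Prod>i\<in>S. x i) * (\<Prod>i\<in>M - S. 1 - x i)"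
      by (simp add: cube_point_def)
    have v: "v \<subseteq> {1..n}" using QR_apply_subset[OF cube S(1)] S(2) by simp
    let ?t = "\<lambda>i. max 0 (1 - \<bar>?H i - height n v i\<bar>)"
    have h: "height n v i = height n A i + (if i \<in> S then direction A i else 0)" for i
      using height_QR_apply[OF cube S(1)] S(2) by simp
    have tS: "?t i = x i" if "i \<in> S" for i
      using x that S(1) by (auto simp: h cube_profile_def direction_def subset_iff)
    have tM: "?t i = 1 - x i" if "i \<in> M - S" for i
      using x that by (auto simp: h cube_profile_def direction_def)
    have tn: "?t i = 1" if "i \<in> {1..n} - M" for i
      using that S(1) by (auto simp: h cube_profile_def)
    have "weights n ?H v = prod ?t {1..n}" using v by (simp add: weights_def)
    also have "\<dots> = prod ?t ({1..n} - M) * prod ?t M"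
      using M by (intro prod.subset_diff) auto
    also have "prod ?t M = prod ?t (M - S) * prod ?t S"
      using S arm_cube_props(3)[OF cube] by (intro prod.subset_diff) auto
    also have "prod ?t ({1..n} - M) = 1" using tn by simp
    finally show ?thesis using 1 tS tM by simp
  next
    case False
    have "{T. T \<subseteq> M \<and> QR_apply n A T = v} = {}" using False by blast
    then have 1: "cube_point (M, QR_apply n A) x v = 0"
      by (simp only: cube_point_def fst_conv snd_conv sum.empty)
    have "weights n ?H v = 0"
    proof (cases "v \<subseteq> {1..n}")
      case v: True
      have "\<not> 0 < weights n ?H v"
      proof
        assume "0 < weights n ?H v"
        then have near: "\<bar>?H i - height n v i\<bar> < 1" if "i \<in> {1..n}" for i
          using weights_pos_iff[OF v] that by blast
        \<comment> \<open>The moves at which \<open>v\<close> differs from the base state; applying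
          them should give \<open>v\<close>.\<close>
        define S where "S = {i \<in> M. height n v i \<noteq> height n A i}"
        have "height n (QR_apply n A S) i = height n v i" for i
        proof (cases "i \<in> {1..n}")
          case True
          obtain k where k: "height n v i = height n A i + of_int k"
            using integral_profilesD(2)[OF height_integral_profile, of n v i]
              integral_profilesD(2)[OF height_integral_profile, of n A i]
            by (metis Ints_cases Ints_diff add_diff_cancel_left' diff_add_cancel add.commute)
          show ?thesis
          proof (cases "i \<in> M")
            case False
            then have "\<bar>real_of_int k\<bar> < 1" using near[OF True] k by (simp add: cube_profile_def)
            then have "k = 0" by linarith
            then show ?thesis using k False height_QR_apply[OF cube, of S i] by (auto simp: S_def)
          next
            case iM: True
            have "real_of_int k = 0 \<or> real_of_int k = direction A i"
            proof (cases "i \<in> A")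
              case True
              then have "- 2 < real_of_int k" "real_of_int k < 1"
                using near[OF \<open>i \<in> {1..n}\<close>] k iM x[rule_format, OF iM] by (auto simp: cube_profile_def direction_def)
              then have "k = 0 \<or> k = - 1" by linarith
              then show ?thesis using True by (auto simp: direction_def)
            next
              case False
              then have "- 1 < real_of_int k" "real_of_int k < 2"
                using near[OF \<open>i \<in> {1..n}\<close>] k iM x[rule_format, OF iM] by (auto simp: cube_profile_def direction_def)
              then have "k = 0 \<or> k = 1" by linarith
              then show ?thesis using False by (auto simp: direction_def)
            qed
            then show ?thesis
              using k iM height_QR_apply[OF cube, of S i] by (auto simp: S_def)
          qed
        next
          case False
          then have "i = 0 \<or> n < i" by auto
          then show ?thesis by (auto simp: height_beyond)
        qed
        then have "height n (QR_apply n A S) = height n v" by blast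
        moreover have "S \<subseteq> M" by (auto simp: S_def)
        ultimately have "QR_apply n A S = v"
          using height_inj QR_apply_subset[OF cube] v by blast
        then show False using \<open>\<not> (\<exists>S\<subseteq>M. QR_apply n A S = v)\<close> \<open>S \<subseteq> M\<close> by blast
      qed
      moreover have "0 \<le> weights n ?H v" unfolding weights_def by (simp add: prod_nonneg)
      ultimately show ?thesis by simp
    qed (simp add: weights_def)
    then show ?thesis using 1 by simp
  qed
qed

text \<open>A face fixes the coordinates in \<open>Z\<close> at 0 and those in \<open>U\<close> at
  1. Its lowest vertex also performs the free moves that start at a north link, which go down; the
  highest vertex performs the other free moves. Both are heights of states, hence integral.\<close>

definition face_min :: "nat \<Rightarrow> nat set \<Rightarrow> nat set \<Rightarrow> nat set \<Rightarrow> nat set \<Rightarrow> nat \<Rightarrow> real" where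
  "face_min n M A Z U = height n (QR_apply n A (U \<union> ((M - Z) \<inter> A)))"

definition face_max :: "nat \<Rightarrow> nat set \<Rightarrow> nat set \<Rightarrow> nat set \<Rightarrow> nat set \<Rightarrow> nat \<Rightarrow> real" where
  "face_max n M A Z U = height n (QR_apply n A (U \<union> ((M - Z) - A)))"

lemma face_bounds:
  assumes "arm_cube n M A" "U \<subseteq> M"
  shows "face_min n M A Z U i = height n A i +
      (if i \<in> U then direction A i else if i \<in> M - Z then min 0 (direction A i) else 0)"
    and "face_max n M A Z U i = height n A i +
      (if i \<in> U then direction A i else if i \<in> M - Z then max 0 (direction A i) else 0)"
proof -
  have sub: "U \<union> ((M - Z) \<inter> A) \<subseteq> M" "U \<union> ((M - Z) - A) \<subseteq> M" using assms(2) by blast+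
  show "face_min n M A Z U i = height n A i +
      (if i \<in> U then direction A i else if i \<in> M - Z then min 0 (direction A i) else 0)"
    unfolding face_min_def height_QR_apply[OF assms(1) sub(1)] by (auto simp: direction_def)
  show "face_max n M A Z U i = height n A i +
      (if i \<in> U then direction A i else if i \<in> M - Z then max 0 (direction A i) else 0)"
    unfolding face_max_def height_QR_apply[OF assms(1) sub(2)] by (auto simp: direction_def)
qed

lemma face_cell:
  assumes "arm_cube n M A" "U \<subseteq> M"
  shows "cell n (face_min n M A Z U) (face_max n M A Z U)"
  unfolding cell_def
proof (intro conjI allI impI)
  show "face_min n M A Z U \<in> integral_profiles n" "face_max n M A Z U \<in> integral_profiles n"
    unfolding face_min_def face_max_def by (rule height_integral_profile)+
  show "face_min n M A Z U i \<le> face_max n M A Z U i" "face_max n M A Z U i \<le> face_min n M A Z U i + 1" for i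
    unfolding face_bounds[OF assms] by (auto simp: direction_def)
  show "face_min n M A Z U i = face_max n M A Z U i \<or> face_min n M A Z U (Suc i) = face_max n M A Z U (Suc i)" for i
    using arm_cube_props(4)[OF assms(1), of i] assms(2) unfolding face_bounds[OF assms] by auto
qed

lemma face_image:
  assumes cube: "arm_cube n M A" and ZU: "Z \<subseteq> M" "U \<subseteq> M" "Z \<inter> U = {}"
  shows "cube_profile n M A ` {x \<in> unit_coords (M, QR_apply n A). (\<forall>i\<in>Z. x i = 0) \<and> (\<forall>i\<in>U. x i = 1)}
    = box_fun (face_min n M A Z U) (face_max n M A Z U)"
    (is "_ ` ?X = ?B")
proof
  show "cube_profile n M A ` ?X \<subseteq> ?B"
    using ZU unfolding box_fun_def face_bounds[OF cube ZU(2)] cube_profile_def unit_coords_def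
    by (auto simp: direction_def)
  show "?B \<subseteq> cube_profile n M A ` ?X"
  proof
    fix H assume H: "H \<in> ?B"
    \<comment> \<open>Each \<open>direction\<close> is 1 or -1, so multiplying by it again solves
      for the cube coordinate.\<close>
    let ?x = "\<lambda>i. direction A i * (H i - height n A i)"
    note b = box_funD[OF H, unfolded face_bounds[OF cube ZU(2)]]
    have "H = cube_profile n M A ?x"
    proof
      fix i
      show "H i = cube_profile n M A ?x i"
      proof (cases "i \<in> M")
        case False
        then have "i \<notin> U" using ZU(2) by blast
        then show ?thesis using b[of i] False by (auto simp: cube_profile_def)
      qed (auto simp: cube_profile_def direction_def)
    qed
    moreover have "?x \<in> ?X"
    proof -
      have "?x i \<in> {0..1}" if "i \<in> M" for i
        using b[of i] that by (auto simp: direction_def split: if_splits)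
      moreover have "?x i = 0" if "i \<in> Z" for i
        using b[of i] that ZU by (auto simp: direction_def split: if_splits)
      moreover have "?x i = 1" if "i \<in> U" for i
        using b[of i] that by (auto simp: direction_def split: if_splits)
      ultimately show ?thesis by (simp add: unit_coords_def)
    qed
    ultimately show "H \<in> cube_profile n M A ` ?X" by blast
  qed
qed

lemma cube_point_face:
  assumes "arm_cube n M A" "Z \<subseteq> M" "U \<subseteq> M" "Z \<inter> U = {}"
  shows "cube_point (M, QR_apply n A) ` {x \<in> unit_coords (M, QR_apply n A). (\<forall>i\<in>Z. x i = 0) \<and> (\<forall>i\<in>U. x i = 1)}
    = weights n ` box_fun (face_min n M A Z U) (face_max n M A Z U)"
  unfolding face_image[OF assms, symmetric] image_image
  by (rule image_cong) (auto simp: unit_coords_def cube_point_eq_weights[OF assms(1)])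

abbreviation cube_min :: "nat \<Rightarrow> nat set \<Rightarrow> nat set \<Rightarrow> nat \<Rightarrow> real" where
  "cube_min n M A \<equiv> face_min n M A {} {}"

abbreviation cube_max :: "nat \<Rightarrow> nat set \<Rightarrow> nat set \<Rightarrow> nat \<Rightarrow> real" where
  "cube_max n M A \<equiv> face_max n M A {} {}"

lemma cube_carrier_eq:
  assumes "arm_cube n M A"
  shows "cube_carrier (M, QR_apply n A) = weights n ` box_fun (cube_min n M A) (cube_max n M A)"
  using cube_point_face[OF assms, of "{}" "{}"] by (simp add: cube_carrier_def)

text \<open>Integrality leaves each coordinate of the small box either the full unit interval or one
  of its ends: \<open>Z\<close> collects those stuck at the base state, \<open>U\<close> those stuck
  at the opposite end.\<close>

lemma subcell_in_cube_faces:
  assumes cube: "arm_cube n M A"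
    and lohi: "lo \<in> integral_profiles n" "hi \<in> integral_profiles n"
    and le: "\<And>i. cube_min n M A i \<le> lo i" "\<And>i. lo i \<le> hi i" "\<And>i. hi i \<le> cube_max n M A i"
  shows "weights n ` box_fun lo hi \<in> cube_faces (M, QR_apply n A)"
proof -
  define Z where "Z = {i \<in> M. lo i = height n A i \<and> hi i = height n A i}"
  define U where "U = {i \<in> M. lo i = hi i \<and> lo i \<noteq> height n A i}"
  have ZU: "Z \<subseteq> M" "U \<subseteq> M" "Z \<inter> U = {}" by (auto simp: Z_def U_def)
  have "lo i = face_min n M A Z U i \<and> hi i = face_max n M A Z U i" for i
  proof (cases "i \<in> M")
    case False
    then show ?thesis
      using le[of i] ZU unfolding face_bounds[OF cube ZU(2)] face_bounds[OF cube empty_subsetI] by auto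
  next
    case True
    have Ints: "lo i \<in> \<int>" "hi i \<in> \<int>" "height n A i \<in> \<int>"
      using integral_profilesD(2) lohi height_integral_profile by blast+
    have b: "height n A i + min 0 (direction A i) \<le> lo i" "hi i \<le> height n A i + max 0 (direction A i)"
      using le[of i] True unfolding face_bounds[OF cube empty_subsetI] by auto
    show ?thesis
    proof (cases "i \<in> A")
      case A: True
      let ?m = "height n A i - 1"
      have "lo i = ?m \<or> lo i = ?m + 1" "hi i = ?m \<or> hi i = ?m + 1"
        using Ints b A le(2)[of i] Ints_le_cases[of ?m "lo i"] Ints_le_cases[of ?m "hi i"]
        by (auto simp: direction_def)
      then show ?thesis
        using True A le(2)[of i] unfolding face_bounds[OF cube ZU(2)]
        by (auto simp: direction_def Z_def U_def)
    next
      case A: False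
      let ?m = "height n A i"
      have "lo i = ?m \<or> lo i = ?m + 1" "hi i = ?m \<or> hi i = ?m + 1"
        using Ints b A le(2)[of i] Ints_le_cases[of ?m "lo i"] Ints_le_cases[of ?m "hi i"]
        by (auto simp: direction_def)
      then show ?thesis
        using True A le(2)[of i] unfolding face_bounds[OF cube ZU(2)]
        by (auto simp: direction_def Z_def U_def)
    qed
  qed
  then have "lo = face_min n M A Z U" "hi = face_max n M A Z U" by auto
  then have "weights n ` box_fun lo hi = cube_point (M, QR_apply n A) `
      {x \<in> unit_coords (M, QR_apply n A). (\<forall>i\<in>Z. x i = 0) \<and> (\<forall>i\<in>U. x i = 1)}"
    using cube_point_face[OF cube ZU] by simp
  then show ?thesis unfolding cube_faces_def using ZU by auto
qed

text \<open>The base state is the lowest vertex, so all moves raise. Where \<open>i\<close> varies,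
  its neighbours are fixed and must fit both \<open>a i\<close> and \<open>a i + 1\<close>; this
  forces link \<open>i\<close> east and link \<open>i + 1\<close> north, which is applicability of
  move \<open>i\<close>.\<close>

lemma cell_is_cube:
  assumes c: "cell n a b"
  obtains M A where "arm_cube n M A" "cube_min n M A = a" "cube_max n M A = b"
proof -
  have aI: "a \<in> integral_profiles n" and bI: "b \<in> integral_profiles n"
    using c cell_integral by blast+
  note ap = integral_profilesD(1)[OF aI] and bp = integral_profilesD(1)[OF bI]
  obtain A where A: "A \<subseteq> {1..n}" "height n A = a" using height_surj[OF aI] .
  define M where "M = {i. a i \<noteq> b i}"
  have b: "b i = a i + (if i \<in> M then 1 else 0)" for i
    using cellD(1,2)[OF c, of i] Ints_le_cases[of "a i" "b i"] integral_profilesD(2)[OF aI] integral_profilesD(2)[OF bI]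
    by (auto simp: M_def)
  have M: "M \<subseteq> {1..n}"
  proof
    fix i assume "i \<in> M"
    then have "a i \<noteq> b i" by (simp add: M_def)
    then have "i \<noteq> 0" "\<not> n < i"
      using profiles_zero[OF ap] profiles_zero[OF bp] by metis+
    then show "i \<in> {1..n}" by auto
  qed
  have sep: "i \<notin> M \<or> Suc i \<notin> M" if "i < n" for i
    using cellD(3)[OF c that] by (auto simp: M_def)
  have slope: "a i \<le> a (Suc i)" "b i \<le> b (Suc i)" "b (Suc i) \<le> b i + 1" if "i < n" for i
    using unit_step_slope profiles_step[OF ap that] profiles_step[OF bp that] by blast+
  have notA: "i \<notin> A" if i: "i \<in> M" for i
  proof -
    obtain k where k: "i = Suc k" "k < n" using i M by (cases i) auto
    then have "k \<notin> M" using sep i by auto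
    then have "a i \<le> a k" using slope[OF k(2)] b[of i] b[of k] i k by auto
    then show ?thesis using height_Suc[OF k(2), of A] A(2) k by (auto split: if_splits)
  qed
  have inA: "Suc i \<in> A" if "i \<in> M" "i < n" for i
  proof -
    have "Suc i \<notin> M" using sep that by auto
    then have "a i + 1 \<le> a (Suc i)" using slope[OF that(2)] b[of i] b[of "Suc i"] that by auto
    then show ?thesis using height_Suc[OF that(2), of A] A(2) by (cases "Suc i \<in> A") auto
  qed
  have "disjoint_family_on (QR_links n) M"
    unfolding disjoint_family_on_def
  proof (intro ballI impI)
    fix i j assume ij: "i \<in> M" "j \<in> M" "i \<noteq> j"
    then have "i \<le> n" "j \<le> n" using M by auto
    then have "j \<noteq> Suc i" "i \<noteq> Suc j" using sep[of i] sep[of j] ij by auto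
    then show "QR_links n i \<inter> QR_links n j = {}"
      using ij \<open>i \<le> n\<close> \<open>j \<le> n\<close> by (auto simp: QR_links_def)
  qed
  then have cube: "arm_cube n M A"
    unfolding arm_cube_def using A M notA inA by (auto simp: QR_applicable_def)
  have "cube_min n M A i = a i \<and> cube_max n M A i = b i" for i
    using notA b[of i] A(2) unfolding face_bounds[OF cube empty_subsetI] by (auto simp: direction_def)
  then show thesis using that[OF cube] by blast
qed

lemma cell_box_nonempty_le:
  assumes "box_fun a b \<noteq> {}"
  shows "a i \<le> b i"
  using assms box_funD order_trans by blast

lemma weights_image_Int:
  assumes "S \<subseteq> profiles n" "T \<subseteq> profiles n"
  shows "weights n ` S \<inter> weights n ` T = weights n ` (S \<inter> T)"
  using inj_on_image_Int[OF weights_inj assms] by simp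

text \<open>Faces are boxes of cells and every cell is a cube. Two cubes meet in the box between the
  maximum of their lower and the minimum of their upper corners, which are again integral
  profiles.\<close>

lemma cubical_complex_QR: "cubical_complex (QR_state_complex n)"
  unfolding cubical_complex_def
proof (intro conjI ballI impI)
  fix C assume "C \<in> QR_state_complex n"
  then obtain M A where C: "C = (M, QR_apply n A)" "arm_cube n M A"
    using QR_state_complex_iff by blast
  show "finite (fst C)" "inj_on (snd C) (Pow (fst C))"
    using C arm_cube_props(3) QR_apply_inj by auto
  show "\<exists>D\<in>QR_state_complex n. cube_carrier D = F" if F_face: "F \<in> cube_faces C" for F
  proof -
    obtain Z U where ZU: "Z \<subseteq> M" "U \<subseteq> M" "Z \<inter> U = {}"
      and F: "F = cube_point C ` {x \<in> unit_coords C. (\<forall>i\<in>Z. x i = 0) \<and> (\<forall>i\<in>U. x i = 1)}"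
      using F_face unfolding cube_faces_def C(1) by auto
    have F': "F = weights n ` box_fun (face_min n M A Z U) (face_max n M A Z U)"
      unfolding F C(1) by (rule cube_point_face[OF C(2) ZU])
    obtain N B where "arm_cube n N B" "cube_min n N B = face_min n M A Z U" "cube_max n N B = face_max n M A Z U"
      using cell_is_cube[OF face_cell[OF C(2) ZU(2)]] .
    then show ?thesis
      using F' cube_carrier_eq QR_state_complex_iff by metis
  qed
  fix D assume "D \<in> QR_state_complex n"
  then obtain N B where D: "D = (N, QR_apply n B)" "arm_cube n N B"
    using QR_state_complex_iff by blast
  assume ne: "cube_carrier C \<inter> cube_carrier D \<noteq> {}"
  let ?a = "cube_min n M A" and ?b = "cube_max n M A" and ?c = "cube_min n N B" and ?e = "cube_max n N B"
  have cells: "cell n ?a ?b" "cell n ?c ?e"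
    using face_cell C(2) D(2) by blast+
  let ?lo = "\<lambda>i. max (?a i) (?c i)" and ?hi = "\<lambda>i. min (?b i) (?e i)"
  have "box_fun ?a ?b \<inter> box_fun ?c ?e = box_fun ?lo ?hi"
    by (auto simp: box_fun_def)
  then have I: "cube_carrier C \<inter> cube_carrier D = weights n ` box_fun ?lo ?hi"
    unfolding C(1) D(1) cube_carrier_eq[OF C(2)] cube_carrier_eq[OF D(2)]
    using weights_image_Int[of "box_fun ?a ?b" n "box_fun ?c ?e"] cell_box_profiles cells by blast
  then have le: "?lo i \<le> ?hi i" for i
    using ne cell_box_nonempty_le[of ?lo ?hi i] by auto
  have lohi: "?lo \<in> integral_profiles n" "?hi \<in> integral_profiles n"
    using max_integral_profiles min_integral_profiles cells cell_integral by blast+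
  show "cube_carrier C \<inter> cube_carrier D \<in> cube_faces C \<inter> cube_faces D"
    unfolding I unfolding C(1) D(1)
    by (intro IntI subcell_in_cube_faces C(2) D(2) lohi le) auto
qed

section \<open>Isometry between the state complex and the space of profiles\<close>

lemma cube_profile_box:
  assumes "arm_cube n M A"
  shows "cube_profile n M A ` unit_coords (M, QR_apply n A) = box_fun (cube_min n M A) (cube_max n M A)"
  using face_image[OF assms, of "{}" "{}"] by simp

lemma complex_points_QR: "complex_points (QR_state_complex n) = weights n ` profiles n"
proof
  show "complex_points (QR_state_complex n) \<subseteq> weights n ` profiles n"
  proof
    fix p assume "p \<in> complex_points (QR_state_complex n)"
    then obtain C where "C \<in> QR_state_complex n" "p \<in> cube_carrier C"
      unfolding complex_points_def by blast
    then obtain M A where "arm_cube n M A" "p \<in> cube_carrier (M, QR_apply n A)"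
      using QR_state_complex_iff by metis
    then show "p \<in> weights n ` profiles n"
      using cube_carrier_eq face_cell[of n M A "{}" "{}"] cell_box_profiles by blast
  qed
  show "weights n ` profiles n \<subseteq> complex_points (QR_state_complex n)"
  proof
    fix p assume "p \<in> weights n ` profiles n"
    then obtain H where H: "H \<in> profiles n" "p = weights n H" by blast
    obtain M A where "arm_cube n M A" "cube_min n M A = (\<lambda>i. of_int \<lfloor>H i\<rfloor>)" "cube_max n M A = (\<lambda>i. of_int \<lceil>H i\<rceil>)"
      using cell_is_cube[OF rounding_cell(1)[OF H(1)]] .
    then show "p \<in> complex_points (QR_state_complex n)"
      unfolding complex_points_def
      using QR_state_complex_iff cube_carrier_eq rounding_cell(2)[OF H(1)] H(2) by fastforce
  qed
qed

lemma l2_cube_profile: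
  assumes "arm_cube n M A"
  shows "l2 n (cube_profile n M A x) (cube_profile n M A y) = L2_set (\<lambda>i. x i - y i) M"
proof -
  have M: "M \<subseteq> {..n}" using arm_cube_props(2)[OF assms] by auto
  have "(\<Sum>i\<le>n. (cube_profile n M A x i - cube_profile n M A y i)\<^sup>2) = (\<Sum>i\<in>M. (x i - y i)\<^sup>2)"
  proof (rule sum.mono_neutral_cong_right)
    fix i assume "i \<in> M"
    then show "(cube_profile n M A x i - cube_profile n M A y i)\<^sup>2 = (x i - y i)\<^sup>2"
      by (auto simp: cube_profile_def direction_def power2_commute)
  qed (use M in \<open>auto simp: cube_profile_def\<close>)
  then show ?thesis by (simp add: l2_def L2_set_def)
qed

lemma pl_path_imp_chain:
  assumes "pl_path (QR_state_complex n) p l q"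
  shows "\<exists>x y. p = weights n x \<and> q = weights n y \<and> chain n x l y"
  using assms
proof (induction rule: pl_path.induct)
  case (const p)
  then show ?case using chain.refl complex_points_QR by fastforce
next
  case (segment C x y l q)
  obtain M A where C: "C = (M, QR_apply n A)" "arm_cube n M A"
    using segment(1) QR_state_complex_iff by blast
  obtain y' z where yz: "cube_point C y = weights n y'" "q = weights n z" "chain n y' l z"
    using segment by blast
  let ?x = "cube_profile n M A x" and ?y = "cube_profile n M A y"
  have w: "cube_point C x = weights n ?x" "cube_point C y = weights n ?y"
    using segment(2,3) cube_point_eq_weights[OF C(2)] unfolding C(1) unit_coords_def by auto
  have box: "?x \<in> box_fun (cube_min n M A) (cube_max n M A)" "?y \<in> box_fun (cube_min n M A) (cube_max n M A)"
    using segment(2,3) cube_profile_box[OF C(2)] unfolding C(1) by blast+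
  have c: "cell n (cube_min n M A) (cube_max n M A)" using face_cell[OF C(2)] by blast
  \<comment> \<open>Successive segments may lie in different cubes; injectivity of
    \<open>weights\<close> shows that their common end has one profile.\<close>
  have "?y = y'"
    using weights_inj yz w cell_box_profiles[OF c box(2)] chain_profiles[OF yz(3)] by (metis inj_onD)
  moreover have "cell_adjacent n ?x ?y" unfolding cell_adjacent_def using c box by blast
  ultimately have "chain n ?x (l2 n ?x ?y + l) z" using yz chain.step by blast
  then show ?case
    using w yz l2_cube_profile[OF C(2)] C(1) by auto
qed

lemma chain_imp_pl_path:
  assumes "chain n x l y"
  shows "pl_path (QR_state_complex n) (weights n x) l (weights n y)"
  using assms
proof (induction rule: chain.induct)
  case (refl x)
  then show ?case using complex_points_QR by (intro pl_path.const) auto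
next
  case (step x y l z)
  obtain a b where ab: "cell n a b" "x \<in> box_fun a b" "y \<in> box_fun a b"
    using step(1) unfolding cell_adjacent_def by blast
  obtain M A where cube: "arm_cube n M A" "cube_min n M A = a" "cube_max n M A = b"
    using cell_is_cube[OF ab(1)] .
  let ?C = "(M, QR_apply n A)"
  obtain x' y' where xy: "x' \<in> unit_coords ?C" "y' \<in> unit_coords ?C"
      "x = cube_profile n M A x'" "y = cube_profile n M A y'"
    using ab cube_profile_box[OF cube(1)] cube by blast
  have w: "cube_point ?C x' = weights n x" "cube_point ?C y' = weights n y"
    using xy cube_point_eq_weights[OF cube(1)] unfolding unit_coords_def by auto
  have C: "?C \<in> QR_state_complex n" using cube QR_state_complex_iff by blast
  have "pl_path (QR_state_complex n) (cube_point ?C x') (L2_set (\<lambda>i. x' i - y' i) (fst ?C) + l) (weights n z)"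
    using pl_path.segment[OF C xy(1,2)] step(3) w by simp
  then show ?case using w xy l2_cube_profile[OF cube(1)] by simp
qed

lemma pl_path_iff_chain:
  assumes "x \<in> profiles n" "y \<in> profiles n"
  shows "pl_path (QR_state_complex n) (weights n x) l (weights n y) \<longleftrightarrow> chain n x l y"
  using pl_path_imp_chain[of n "weights n x" l "weights n y"] chain_imp_pl_path chain_profiles
    weights_inj[of n] assms by (metis inj_onD)

lemma complex_dist_QR:
  assumes "x \<in> profiles n" "y \<in> profiles n"
  shows "complex_dist (QR_state_complex n) (weights n x) (weights n y) = chain_dist n x y"
  unfolding complex_dist_def chain_dist_def using pl_path_iff_chain[OF assms] by simp

text \<open>\<open>Metric_space\<close> demands nonnegativity and symmetry for all arguments, also
  off the carrier, where the dummy value applies.\<close>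

lemma complex_dist_outside:
  assumes "p \<notin> weights n ` profiles n \<or> q \<notin> weights n ` profiles n"
  shows "complex_dist (QR_state_complex n) p q = 0"
  unfolding complex_dist_def using pl_path_imp_chain chain_profiles assms by fastforce

lemma QR_metric: "Metric_space (weights n ` profiles n) (complex_dist (QR_state_complex n))"
proof -
  interpret Metric_space "profiles n" "chain_dist n" by (rule chain_dist_metric)
  let ?D = "complex_dist (QR_state_complex n)"
  show ?thesis
  proof
    fix p q
    show "0 \<le> ?D p q"
      using complex_dist_outside[of p n q] complex_dist_QR
      by (cases "p \<in> weights n ` profiles n \<and> q \<in> weights n ` profiles n") auto
    show "?D p q = ?D q p"
      using complex_dist_outside[of p n q] complex_dist_outside[of q n p] complex_dist_QR commute
      by (cases "p \<in> weights n ` profiles n \<and> q \<in> weights n ` profiles n") auto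
  next
    fix p q assume "p \<in> weights n ` profiles n" "q \<in> weights n ` profiles n"
    then obtain x y where "x \<in> profiles n" "y \<in> profiles n" "p = weights n x" "q = weights n y"
      by blast
    then show "?D p q = 0 \<longleftrightarrow> p = q"
      using inj_on_eq_iff[OF weights_inj, of x n y] zero[of x y] by (simp add: complex_dist_QR)
  next
    fix p q r assume "p \<in> weights n ` profiles n" "q \<in> weights n ` profiles n" "r \<in> weights n ` profiles n"
    then obtain x y z where "x \<in> profiles n" "y \<in> profiles n" "z \<in> profiles n"
      "p = weights n x" "q = weights n y" "r = weights n z" by blast
    then show "?D p r \<le> ?D p q + ?D q r"
      using triangle[of x y z] by (simp add: complex_dist_QR)
  qed
qed

lemma QR_CN_space: "CN_space (weights n ` profiles n) (complex_dist (QR_state_complex n))"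
  unfolding CN_space_def
proof (intro ballI)
  fix q r and t :: real assume "q \<in> weights n ` profiles n" "r \<in> weights n ` profiles n" and t: "t \<in> {0..1}"
  then obtain x y where xy: "x \<in> profiles n" "y \<in> profiles n" "q = weights n x" "r = weights n y" by blast
  obtain m where "CN_point (chain_dist n) (profiles n) x y t m"
    using CN_space_profiles xy t unfolding CN_space_def by blast
  then have "CN_point (complex_dist (QR_state_complex n)) (weights n ` profiles n) q r t (weights n m)"
    unfolding CN_point_def using xy by (auto simp: complex_dist_QR)
  then show "\<exists>m. CN_point (complex_dist (QR_state_complex n)) (weights n ` profiles n) q r t m" by blast
qed

theorem theorem4p9:
  fixes n :: nat
  assumes "n \<ge> 1"
  shows "CAT0_cubical_complex (QR_state_complex n)"
  unfolding CAT0_cubical_complex_def complex_points_QR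
  using cubical_complex_QR Metric_space.CN_imp_CAT0[OF QR_metric QR_CN_space] by blast

end
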